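(* In the setting below, assume the path $(Z_1,Z_2)$ minimizes the action, $Z_1(0)=0$, $Z_2(0)\neq0$ lies on the positive $x$-axis, $Z_1(1)\in\overline{\mathsf{Q}_1}$ and $Z_2(1)\in\overline{\mathsf{Q}_4}$. If $Z_1(1)\in\mathsf{Q}_1$ or $Z_2(1)\in\mathsf{Q}_4$, then $Z_1(t)\in\overline{\mathsf{Q}_1}$ and $Z_2(t)\in\overline{\mathsf{Q}_4}$ for all $t\in[0,1]$, i.e. $Z_i(t)=\widetilde Z_i(t)$ for all $t\in[0,1]$, $i=1,2$. If both $Z_1(1)$ and $Z_2(1)$ lie on the positive $x$-axis, then either $Z_1(t)\in\overline{\mathsf{Q}_1}$ and $Z_2(t)\in\overline{\mathsf{Q}_4}$ for all $t\in[0,1]$, or $Z_1(t)\in\overline{\mathsf{Q}_4}$ and $Z_2(t)\in\overline{\mathsf{Q}_1}$ for all $t\in[0,1]$.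
   Context: Planar three-body problem with masses $m_1=m_2=m_3=1$, $\chi=\{q=(q_1,q_2,q_3)\in(\mathbb{R}^2)^3: q_1+q_2+q_3=0\}$. Let $Q_{S_4}=\{q: q_1=q_2=(-a_2,0),\ q_3=(2a_2,0),\ a_2\ge0\}$ and $Q_{E_1}=\{q: q_1=(0,-2b_1),\ q_2=(-b_2,b_1),\ q_3=(b_2,b_1),\ b_1,b_2\in\mathbb{R}\}$. The path $q$ minimizes $\mathcal{A}(q)=\int_0^1\big(\tfrac12\sum|\dot q_i|^2+\sum_{i<j}\frac{1}{|q_i-q_j|}\big)dt$ over $\{q\in H^1([0,1],\chi): q(0)\in Q_{S_4},\ q(1)\in Q_{E_1}\}$; it is collision-free for $t\in(0,1]$ and satisfies Newton's equations there. Jacobi coordinates $Z_1=q_1-q_2=(Z_{1x},Z_{1y})$, $Z_2=q_3-\frac{q_1+q_2}{2}=(Z_{2x},Z_{2y})$. $\widetilde Z_1(t)=(|Z_{1x}(t)|,|Z_{1y}(t)|)$, $\widetilde Z_2(t)=(|Z_{2x}(t)|,-|Z_{2y}(t)|)$. $\mathsf{Q}_i$ is the open $i$-th quadrant of the plane (e.g. $\mathsf{Q}_1=\{x>0,y>0\}$) and $\overline{\mathsf{Q}_i}$ its closure. *)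

theory Defs
  imports "HOL-Analysis.Analysis"
begin

type_synonym pt = "real \<times> real"

definition H1_path :: "(real \<Rightarrow> pt) \<Rightarrow> bool" where
  "H1_path f \<longleftrightarrow> (\<exists>g::real \<Rightarrow> pt. g \<in> borel_measurable lborel \<and>
      set_integrable lborel {0..1} g \<and>
      set_nn_integral lborel {0..1} (\<lambda>t. ennreal ((norm (g t))\<^sup>2)) < \<infinity> \<and>
      (\<forall>t\<in>{0..1}. f t = f 0 + (LINT s:{0..t}|lborel. g s)))"

definition inv_dist :: "pt \<Rightarrow> pt \<Rightarrow> ennreal" where
  "inv_dist x y = (if x = y then \<infinity> else ennreal (1 / dist x y))"

text \<open>The action (values in [0,\<infinity>]); derivatives are the a.e. classical derivatives.\<close>
definition action :: "(real \<Rightarrow> pt) \<Rightarrow> (real \<Rightarrow> pt) \<Rightarrow> (real \<Rightarrow> pt) \<Rightarrow> ennreal" where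
  "action q1 q2 q3 = set_nn_integral lborel {0..1} (\<lambda>t.
      ennreal (((norm (vector_derivative q1 (at t)))\<^sup>2 + (norm (vector_derivative q2 (at t)))\<^sup>2
               + (norm (vector_derivative q3 (at t)))\<^sup>2) / 2)
      + inv_dist (q1 t) (q2 t) + inv_dist (q1 t) (q3 t) + inv_dist (q2 t) (q3 t))"

definition in_Q_S4 :: "pt \<Rightarrow> pt \<Rightarrow> pt \<Rightarrow> bool" where
  "in_Q_S4 x1 x2 x3 \<longleftrightarrow> (\<exists>a2::real. a2 \<ge> 0 \<and> x1 = (-a2, 0) \<and> x2 = (-a2, 0) \<and> x3 = (2*a2, 0))"

definition in_Q_E1 :: "pt \<Rightarrow> pt \<Rightarrow> pt \<Rightarrow> bool" where
  "in_Q_E1 x1 x2 x3 \<longleftrightarrow> (\<exists>b1 b2::real. x1 = (0, -2*b1) \<and> x2 = (-b2, b1) \<and> x3 = (b2, b1))"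

definition admissible :: "(real \<Rightarrow> pt) \<Rightarrow> (real \<Rightarrow> pt) \<Rightarrow> (real \<Rightarrow> pt) \<Rightarrow> bool" where
  "admissible q1 q2 q3 \<longleftrightarrow> H1_path q1 \<and> H1_path q2 \<and> H1_path q3 \<and>
     (\<forall>t\<in>{0..1}. q1 t + q2 t + q3 t = 0) \<and>
     in_Q_S4 (q1 0) (q2 0) (q3 0) \<and> in_Q_E1 (q1 1) (q2 1) (q3 1)"

definition minimizer :: "(real \<Rightarrow> pt) \<Rightarrow> (real \<Rightarrow> pt) \<Rightarrow> (real \<Rightarrow> pt) \<Rightarrow> bool" where
  "minimizer q1 q2 q3 \<longleftrightarrow> admissible q1 q2 q3 \<and>
     (\<forall>p1 p2 p3. admissible p1 p2 p3 \<longrightarrow> action q1 q2 q3 \<le> action p1 p2 p3)"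

definition force :: "pt \<Rightarrow> pt \<Rightarrow> pt \<Rightarrow> pt" where
  "force x y z = (1 / (norm (y - x))^3) *\<^sub>R (y - x) + (1 / (norm (z - x))^3) *\<^sub>R (z - x)"

definition newton_on :: "real set \<Rightarrow> (real \<Rightarrow> pt) \<Rightarrow> (real \<Rightarrow> pt) \<Rightarrow> (real \<Rightarrow> pt) \<Rightarrow> bool" where
  "newton_on S q1 q2 q3 \<longleftrightarrow> (\<exists>v1 v2 v3. \<forall>t\<in>S.
      (q1 has_vector_derivative v1 t) (at t) \<and> (q2 has_vector_derivative v2 t) (at t) \<and>
      (q3 has_vector_derivative v3 t) (at t) \<and>
      (v1 has_vector_derivative force (q1 t) (q2 t) (q3 t)) (at t) \<and>
      (v2 has_vector_derivative force (q2 t) (q1 t) (q3 t)) (at t) \<and>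
      (v3 has_vector_derivative force (q3 t) (q1 t) (q2 t)) (at t))"

definition quadrant1 :: "pt set" where "quadrant1 = {p. fst p > 0 \<and> snd p > 0}"
definition quadrant4 :: "pt set" where "quadrant4 = {p. fst p > 0 \<and> snd p < 0}"
definition pos_x_axis :: "pt set" where "pos_x_axis = {p. fst p > 0 \<and> snd p = 0}"

end

theory Submission
  imports Defs
begin

text \<open>
  Write $z = (Z_{1x}, Z_{1y}, Z_{2x}, Z_{2y})$. Reflecting the components into the closed first and
  fourth quadrants keeps the kinetic energy and lowers $|Z_1 \cdot Z_2|$, hence lowers the potential;
  as $z$ is minimal, this forces $Z_{1x} Z_{1y} Z_{2x} Z_{2y} \le 0$ on $(0,1)$. The reflected path is
  again minimal, so it has no corners: cutting off a corner of $|z_i|$ by a short constant piece saves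
  kinetic energy and costs arbitrarily little potential. Hence every zero of a component in $(0,1)$ is
  a double zero. If only one component vanishes there, Newton's equations give it a second derivative
  that violates the sign condition. If two vanish, they solve a linear homogeneous system and vanish
  identically; the boundary conditions then leave only the collinear motion $Z_{1y} = Z_{2y} = 0$. So
  all components have constant sign, and the claim is read off at the end points.
\<close>

section \<open>Weak velocities\<close>

text \<open>Beyond absolute continuity, this asks for a velocity off a countable set, because the action is
  defined through the classical derivative.\<close>
definition weak_velocity :: "real \<Rightarrow> real \<Rightarrow> (real \<Rightarrow> 'a::euclidean_space) \<Rightarrow> (real \<Rightarrow> 'a) \<Rightarrow> bool" where
  "weak_velocity a b f g \<longleftrightarrow>
     set_borel_measurable borel {a<..<b} g \<and>
     (\<forall>t\<in>{a..b}. (g has_integral (f t - f a)) {a..t}) \<and>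
     (\<exists>K. countable K \<and> (\<forall>t\<in>{a<..<b} - K. (f has_vector_derivative g t) (at t)))"

lemma weak_velocityI:
  assumes "set_borel_measurable borel {a<..<b} g"
    and "\<And>t. t \<in> {a..b} \<Longrightarrow> (g has_integral (f t - f a)) {a..t}"
    and "countable K" and "\<And>t. t \<in> {a<..<b} - K \<Longrightarrow> (f has_vector_derivative g t) (at t)"
  shows "weak_velocity a b f g"
  using assms unfolding weak_velocity_def by blast

lemma weak_velocityE:
  assumes "weak_velocity a b f g"
  obtains K where "countable K" "\<And>t. t \<in> {a<..<b} - K \<Longrightarrow> (f has_vector_derivative g t) (at t)"
  using assms unfolding weak_velocity_def by blast

lemma weak_velocity_measurable:
  "weak_velocity a b f g \<Longrightarrow> set_borel_measurable borel {a<..<b} g"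
  unfolding weak_velocity_def by blast

lemma weak_velocity_has_integral:
  assumes fg: "weak_velocity a b f g" and st: "a \<le> s" "s \<le> t" "t \<le> b"
  shows "(g has_integral (f t - f s)) {s..t}"
proof -
  have from_start: "(g has_integral (f r - f a)) {a..r}" if "r \<in> {a..b}" for r
    using fg that unfolding weak_velocity_def by blast
  have "g integrable_on {s..t}"
    using integrable_on_subinterval[OF has_integral_integrable[OF from_start[of t]]] st by auto
  then have "(g has_integral (f s - f a + integral {s..t} g)) {a..t}"
    using st by (intro has_integral_combine[of a s t] from_start integrable_integral) auto
  then have "f s - f a + integral {s..t} g = f t - f a"
    using from_start[of t] st by (intro has_integral_unique) auto
  then have "integral {s..t} g = f t - f s" by (simp add: algebra_simps)
  with \<open>g integrable_on {s..t}\<close> show ?thesis by (simp add: has_integral_iff)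
qed

lemma weak_velocity_continuous_on:
  assumes fg: "weak_velocity a b f g"
  shows "continuous_on {a..b} f"
proof (cases "a \<le> b")
  case True
  show ?thesis
  proof (rule continuous_on_eq)
    have "g integrable_on {a..b}"
      using weak_velocity_has_integral[OF fg, of a b] True by (auto simp: has_integral_iff)
    then show "continuous_on {a..b} (\<lambda>t. f a + integral {a..t} g)"
      by (intro continuous_intros indefinite_integral_continuous_1)
    show "f a + integral {a..t} g = f t" if "t \<in> {a..b}" for t
      using weak_velocity_has_integral[OF fg, of a t] that by (auto simp: has_integral_iff)
  qed
qed simp

lemma weak_velocity_differentiable:
  assumes f: "continuous_on {a..b} f" and g: "continuous_on {a<..<b} g"
    and deriv: "\<And>t. t \<in> {a<..<b} \<Longrightarrow> (f has_vector_derivative g t) (at t)"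
  shows "weak_velocity a b f g"
proof (rule weak_velocityI)
  show "set_borel_measurable borel {a<..<b} g"
    using g by (intro set_measurable_continuous_on) auto
  show "(g has_integral (f t - f a)) {a..t}" if "t \<in> {a..b}" for t
  proof (rule fundamental_theorem_of_calculus_interior)
    show "continuous_on {a..t} f" by (rule continuous_on_subset[OF f]) (use that in auto)
  qed (use that deriv in auto)
qed (use deriv in auto)

lemma weak_velocity_subinterval:
  assumes fg: "weak_velocity a b f g" and "a \<le> c" "d \<le> b"
  shows "weak_velocity c d f g"
proof (rule weak_velocityE[OF fg], rule weak_velocityI)
  show "set_borel_measurable borel {c<..<d} g"
    by (rule set_borel_measurable_subset[OF weak_velocity_measurable[OF fg]]) (use assms in auto)
  show "(g has_integral (f t - f c)) {c..t}" if "t \<in> {c..d}" for t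
    using that assms(2,3) by (intro weak_velocity_has_integral[OF fg]) auto
qed (use assms(2,3) in auto)

lemma weak_velocity_cong:
  assumes fg: "weak_velocity a b f g"
    and f': "\<And>t. t \<in> {a..b} \<Longrightarrow> f' t = f t" and g': "\<And>t. t \<in> {a<..<b} \<Longrightarrow> g' t = g t"
  shows "weak_velocity a b f' g'"
proof (rule weak_velocityE[OF fg], rule weak_velocityI)
  have "(\<lambda>t. indicator {a<..<b} t *\<^sub>R g' t) = (\<lambda>t. indicator {a<..<b} t *\<^sub>R g t)"
    using g' by (auto simp: fun_eq_iff indicator_def)
  then show "set_borel_measurable borel {a<..<b} g'"
    using weak_velocity_measurable[OF fg] unfolding set_borel_measurable_def by simp
  show "(g' has_integral (f' t - f' a)) {a..t}" if t: "t \<in> {a..b}" for t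
    by (rule has_integral_spike_finite[of "{a, b}"])
      (use weak_velocity_has_integral[OF fg, of a t] t f' g' in auto)
  fix K assume deriv: "\<And>t. t \<in> {a<..<b} - K \<Longrightarrow> (f has_vector_derivative g t) (at t)"
  show "(f' has_vector_derivative g' t) (at t)" if t: "t \<in> {a<..<b} - K" for t
  proof (rule has_vector_derivative_transform_within_open[where S = "{a<..<b}"])
    show "(f has_vector_derivative g' t) (at t)" using deriv[OF t] g' t by simp
  qed (use t f' in auto)
qed

lemma weak_velocity_combine:
  assumes ac: "weak_velocity a c f g" and cb: "weak_velocity c b f g" and order: "a \<le> c" "c \<le> b"
  shows "weak_velocity a b f g"
proof (rule weak_velocityE[OF ac], rule weak_velocityE[OF cb], rule weak_velocityI)
  have "indicator {a<..<b} t *\<^sub>R g t = indicator {a<..<c} t *\<^sub>R g t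
      + (indicator ({c} \<inter> {a<..<b}) t *\<^sub>R g c + indicator {c<..<b} t *\<^sub>R g t)" for t
    using order by (auto simp: indicator_def)
  moreover have "(\<lambda>t. indicator ({c} \<inter> {a<..<b}) t *\<^sub>R g c) \<in> borel_measurable borel" by measurable
  ultimately show "set_borel_measurable borel {a<..<b} g"
    using weak_velocity_measurable[OF ac] weak_velocity_measurable[OF cb]
    unfolding set_borel_measurable_def by simp
  show "(g has_integral (f t - f a)) {a..t}" if t: "t \<in> {a..b}" for t
  proof (cases "t \<le> c")
    case True
    with t show ?thesis using weak_velocity_has_integral[OF ac, of a t] by simp
  next
    case False
    then have "(g has_integral ((f c - f a) + (f t - f c))) {a..t}"
      using t order
      by (intro has_integral_combine[of a c] weak_velocity_has_integral[OF ac]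
          weak_velocity_has_integral[OF cb]) auto
    then show ?thesis by simp
  qed
  fix K L
  assume K: "\<And>t. t \<in> {a<..<c} - K \<Longrightarrow> (f has_vector_derivative g t) (at t)"
    and L: "\<And>t. t \<in> {c<..<b} - L \<Longrightarrow> (f has_vector_derivative g t) (at t)"
  show "(f has_vector_derivative g t) (at t)" if "t \<in> {a<..<b} - (insert c (K \<union> L))" for t
    using that K[of t] L[of t] by (cases "t < c") auto
qed simp

lemma weak_velocity_flatten:
  assumes fg: "weak_velocity a b f g" and order: "a \<le> p" "p \<le> q" "q \<le> b" and level: "f p = c" "f q = c"
  shows "weak_velocity a b (\<lambda>t. if t \<in> {p..q} then c else f t) (\<lambda>t. if t \<in> {p..q} then 0 else g t)"
    (is "weak_velocity a b ?F ?G")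
proof -
  have left: "weak_velocity a p ?F ?G"
    by (rule weak_velocity_cong[OF weak_velocity_subinterval[OF fg]]) (use order level in auto)
  have "weak_velocity p q (\<lambda>_. c) (\<lambda>_. 0)"
    by (intro weak_velocity_differentiable) auto
  then have middle: "weak_velocity p q ?F ?G" by (rule weak_velocity_cong) auto
  have "weak_velocity q b ?F ?G"
    by (rule weak_velocity_cong[OF weak_velocity_subinterval[OF fg]]) (use order level in auto)
  from weak_velocity_combine[OF weak_velocity_combine[OF left middle] this] order
  show ?thesis by simp
qed

lemma weak_velocity_linear:
  assumes fg: "weak_velocity a b f g" and L: "bounded_linear L"
  shows "weak_velocity a b (\<lambda>t. L (f t)) (\<lambda>t. L (g t))"
proof (rule weak_velocityE[OF fg], rule weak_velocityI)
  interpret L: bounded_linear L by (rule L)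
  have "(\<lambda>t. L (indicator {a<..<b} t *\<^sub>R g t)) \<in> borel_measurable borel"
    by (rule borel_measurable_continuous_on[OF linear_continuous_on[OF L]])
      (use weak_velocity_measurable[OF fg] in \<open>simp add: set_borel_measurable_def\<close>)
  then show "set_borel_measurable borel {a<..<b} (\<lambda>t. L (g t))"
    by (simp add: set_borel_measurable_def L.scaleR)
  show "((\<lambda>t. L (g t)) has_integral (L (f t) - L (f a))) {a..t}" if "t \<in> {a..b}" for t
    using has_integral_linear[OF weak_velocity_has_integral[OF fg, of a t] L] that
    by (simp add: o_def L.diff)
  fix K assume deriv: "\<And>t. t \<in> {a<..<b} - K \<Longrightarrow> (f has_vector_derivative g t) (at t)"
  show "((\<lambda>t. L (f t)) has_vector_derivative L (g t)) (at t)" if "t \<in> {a<..<b} - K" for t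
    by (rule L.has_vector_derivative[OF deriv[OF that]])
qed

lemma weak_velocity_componentwise:
  assumes components: "\<And>i. i \<in> Basis \<Longrightarrow> weak_velocity a b (\<lambda>t. f t \<bullet> i) (\<lambda>t. g t \<bullet> i)"
  shows "weak_velocity a b f g"
proof -
  have "\<forall>i\<in>Basis. \<exists>K. countable K \<and>
      (\<forall>t\<in>{a<..<b} - K. ((\<lambda>t. f t \<bullet> i) has_vector_derivative g t \<bullet> i) (at t))"
    using components weak_velocityE by metis
  then obtain K where K: "\<And>i. i \<in> Basis \<Longrightarrow> countable (K i)"
    "\<And>i t. i \<in> Basis \<Longrightarrow> t \<in> {a<..<b} - K i \<Longrightarrow> ((\<lambda>t. f t \<bullet> i) has_vector_derivative g t \<bullet> i) (at t)"
    by metis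
  show ?thesis
  proof (rule weak_velocityI)
    have "(\<lambda>t. (indicator {a<..<b} t *\<^sub>R g t) \<bullet> i) \<in> borel_measurable borel" if "i \<in> Basis" for i
      using weak_velocity_measurable[OF components[OF that]] by (simp add: set_borel_measurable_def)
    then show "set_borel_measurable borel {a<..<b} g"
      unfolding set_borel_measurable_def by (subst borel_measurable_euclidean_space) blast
    show "(g has_integral (f t - f a)) {a..t}" if "t \<in> {a..b}" for t
    proof (rule has_integral_componentwise)
      fix i :: 'a assume "i \<in> Basis"
      from weak_velocity_has_integral[OF components[OF this], of a t] that
      show "((\<lambda>t. g t \<bullet> i) has_integral ((f t - f a) \<bullet> i)) {a..t}" by (simp add: inner_diff_left)
    qed
    show "countable (\<Union>i\<in>Basis. K i)" using K(1) by (intro countable_UN) (auto intro: countable_finite)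
    show "(f has_vector_derivative g t) (at t)" if "t \<in> {a<..<b} - (\<Union>i\<in>Basis. K i)" for t
      unfolding has_vector_derivative_def has_derivative_componentwise_within[of f]
      using K(2) that by (auto simp: has_vector_derivative_def)
  qed
qed

lemma eventually_nonzero_at_transversal_zero:
  fixes f :: "real \<Rightarrow> real"
  assumes "(f has_real_derivative D) (at t)" "f t = 0" "D \<noteq> 0"
  shows "\<forall>\<^sub>F s in at t. f s \<noteq> 0"
proof -
  have "((\<lambda>s. (f s - f t) / (s - t)) \<longlongrightarrow> D) (at t)"
    using assms(1) by (simp add: has_field_derivative_iff)
  then have "\<forall>\<^sub>F s in at t. (f s - f t) / (s - t) \<noteq> 0"
    using assms(3) by (rule tendsto_imp_eventually_ne)
  then show ?thesis by eventually_elim (use assms(2) in auto)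
qed

lemma countable_isolated_points:
  fixes K :: "'a::second_countable_topology set"
  assumes isolated: "\<And>x. x \<in> K \<Longrightarrow> \<exists>T. open T \<and> T \<inter> K = {x}"
  shows "countable K"
proof -
  obtain B :: "'a set set" where "countable B" and basis: "topological_basis B"
    using ex_countable_basis by blast
  have "\<exists>U\<in>B. U \<inter> K = {x}" if x: "x \<in> K" for x
  proof -
    obtain T where T: "open T" "T \<inter> K = {x}" using isolated x by blast
    then obtain U where "U \<in> B" "x \<in> U" "U \<subseteq> T"
      using topological_basisE[OF basis, of T x] by blast
    then show ?thesis using T x by (intro bexI[of _ U]) auto
  qed
  then obtain nbhd where nbhd: "\<And>x. x \<in> K \<Longrightarrow> nbhd x \<in> B \<and> nbhd x \<inter> K = {x}" by metis
  then have "inj_on nbhd K" "nbhd ` K \<subseteq> B" by (auto intro!: inj_onI) (metis singleton_inject)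
  with \<open>countable B\<close> show ?thesis by (metis countable_image_inj_on countable_subset)
qed

lemma countable_transversal_zeros:
  fixes f f' :: "real \<Rightarrow> real"
  assumes deriv: "\<And>t. t \<in> S \<Longrightarrow> (f has_real_derivative f' t) (at t)"
  shows "countable {t \<in> S. f t = 0 \<and> f' t \<noteq> 0}" (is "countable ?K")
proof (rule countable_isolated_points)
  fix t assume t: "t \<in> ?K"
  then have "\<forall>\<^sub>F s in at t. f s \<noteq> 0"
    using eventually_nonzero_at_transversal_zero[OF deriv] by blast
  then obtain T where "open T" "t \<in> T" "\<And>s. s \<in> T \<Longrightarrow> s \<noteq> t \<Longrightarrow> f s \<noteq> 0"
    unfolding eventually_at_topological by blast
  with t have "T \<inter> ?K = {t}" by auto
  with \<open>open T\<close> show "\<exists>T. open T \<and> T \<inter> ?K = {t}" by blast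
qed

lemma has_real_derivative_abs:
  assumes f: "(f has_real_derivative D) (at (t::real))" and double: "f t = 0 \<Longrightarrow> D = 0"
  shows "((\<lambda>s. \<bar>f s\<bar>) has_real_derivative sgn (f t) * D) (at t)"
proof (cases "f t = 0")
  case True
  have "((\<lambda>s. (f s - f t) / (s - t)) \<longlongrightarrow> 0) (at t)"
    using f double[OF True] by (simp add: has_field_derivative_iff)
  then have "((\<lambda>s. \<bar>(f s - f t) / (s - t)\<bar>) \<longlongrightarrow> 0) (at t)"
    by (rule tendsto_rabs_zero)
  then have "((\<lambda>s. (\<bar>f s\<bar> - \<bar>f t\<bar>) / (s - t)) \<longlongrightarrow> 0) (at t)"
    by (rule Lim_null_comparison[rotated]) (simp add: True)
  then show ?thesis using True by (simp add: has_field_derivative_iff)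
next
  case False
  then have "0 < sgn (f t) * f t" by (simp add: sgn_if)
  moreover have "((\<lambda>s. sgn (f t) * f s) \<longlongrightarrow> sgn (f t) * f t) (nhds t)"
    using DERIV_isCont[OF f] by (intro tendsto_intros) (simp add: isCont_def tendsto_at_iff_tendsto_nhds)
  ultimately have "\<forall>\<^sub>F s in nhds t. 0 < sgn (f t) * f s" by (rule order_tendstoD(1)[rotated])
  then have "\<forall>\<^sub>F s in nhds t. \<bar>f s\<bar> = sgn (f t) * f s"
    by eventually_elim (auto simp: sgn_if split: if_splits)
  then show ?thesis
    using DERIV_cmult[OF f, of "sgn (f t)"] by (simp add: DERIV_cong_ev)
qed

lemma has_integral_chain_rule_limit:
  fixes f g \<psi> \<psi>' :: "real \<Rightarrow> real" and \<phi> \<phi>' :: "nat \<Rightarrow> real \<Rightarrow> real"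
  assumes "a \<le> b" "continuous_on {a..b} f"
    and f: "\<And>t. t \<in> {a<..<b} \<Longrightarrow> (f has_real_derivative g t) (at t)"
    and g: "(\<lambda>t. \<bar>g t\<bar>) integrable_on {a..b}"
    and \<phi>: "\<And>k x. (\<phi> k has_real_derivative \<phi>' k x) (at x)" and \<phi>'_le: "\<And>k x. \<bar>\<phi>' k x\<bar> \<le> C"
    and lim: "\<And>x. (\<lambda>k. \<phi> k x) \<longlonglongrightarrow> \<psi> x" "\<And>x. (\<lambda>k. \<phi>' k x) \<longlonglongrightarrow> \<psi>' x"
  shows "((\<lambda>t. \<psi>' (f t) * g t) has_integral (\<psi> (f b) - \<psi> (f a))) {a..b}"
proof (rule has_integral_dominated_convergence)
  show "((\<lambda>t. \<phi>' k (f t) * g t) has_integral (\<phi> k (f b) - \<phi> k (f a))) {a..b}" for k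
  proof (rule fundamental_theorem_of_calculus_interior[OF \<open>a \<le> b\<close>])
    have "continuous_on UNIV (\<phi> k)" using \<phi> DERIV_isCont continuous_at_imp_continuous_on by blast
    then show "continuous_on {a..b} (\<lambda>t. \<phi> k (f t))"
      using assms(2) by (rule continuous_on_compose2) auto
    show "((\<lambda>t. \<phi> k (f t)) has_vector_derivative \<phi>' k (f t) * g t) (at t)" if "t \<in> {a<..<b}" for t
      using DERIV_chain2[OF \<phi> f[OF that]] by (simp add: has_real_derivative_iff_has_vector_derivative)
  qed
  show "(\<lambda>t. C * \<bar>g t\<bar>) integrable_on {a..b}" using g by (intro integrable_on_mult_right)
  show "\<forall>t\<in>{a..b}. norm (\<phi>' k (f t) * g t) \<le> C * \<bar>g t\<bar>" for k
    using \<phi>'_le by (simp add: abs_mult mult_right_mono)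
qed (use lim in \<open>auto intro!: tendsto_intros\<close>)

text \<open>The smooth functions $\sqrt{x^2 + 1/k^2}$ approximate $|x|$, with derivatives bounded by 1.\<close>
lemma has_integral_deriv_abs:
  fixes f g :: "real \<Rightarrow> real"
  assumes "a \<le> b" "continuous_on {a..b} f"
    and "\<And>t. t \<in> {a<..<b} \<Longrightarrow> (f has_real_derivative g t) (at t)"
    and "(\<lambda>t. \<bar>g t\<bar>) integrable_on {a..b}"
  shows "((\<lambda>t. sgn (f t) * g t) has_integral (\<bar>f b\<bar> - \<bar>f a\<bar>)) {a..b}"
proof -
  define \<phi> where "\<phi> k x = sqrt (x\<^sup>2 + (1 / real (Suc k))\<^sup>2)" for k and x :: real
  have pos: "0 < \<phi> k x" for k x by (simp add: \<phi>_def add_nonneg_pos)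
  have deriv: "(\<phi> k has_real_derivative x / \<phi> k x) (at x)" for k x
    using pos[of k x] unfolding \<phi>_def
    by (auto intro!: derivative_eq_intros simp: field_simps)
  have bound: "\<bar>x / \<phi> k x\<bar> \<le> 1" for k x
  proof -
    have "\<bar>x\<bar> \<le> \<phi> k x" unfolding \<phi>_def by (rule real_le_rsqrt) simp
    then show ?thesis using pos[of k x] by (simp add: abs_divide)
  qed
  have "(\<lambda>k. 1 / real (Suc k)) \<longlonglongrightarrow> 0"
    using LIMSEQ_inverse_real_of_nat by (simp add: inverse_eq_divide)
  then have "(\<lambda>k. \<phi> k x) \<longlonglongrightarrow> sqrt (x\<^sup>2 + 0\<^sup>2)" for x
    unfolding \<phi>_def by (intro tendsto_intros)
  then have lim: "(\<lambda>k. \<phi> k x) \<longlonglongrightarrow> \<bar>x\<bar>" for x by simp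
  moreover have "(\<lambda>k. x / \<phi> k x) \<longlonglongrightarrow> sgn x" for x
  proof (cases "x = 0")
    case False
    then show ?thesis
      using tendsto_divide[OF tendsto_const lim, of x x] by (simp add: real_sgn_eq)
  qed simp
  ultimately show ?thesis
    by (intro has_integral_chain_rule_limit[OF assms deriv bound])
qed

lemma weak_velocity_abs:
  assumes f: "continuous_on {a..b} f"
    and deriv: "\<And>t. t \<in> {a<..<b} \<Longrightarrow> (f has_real_derivative g t) (at t)"
    and g: "continuous_on {a<..<b} g" and integrable: "(\<lambda>t. \<bar>g t\<bar>) integrable_on {a..b}"
  shows "weak_velocity a b (\<lambda>t. \<bar>f t\<bar>) (\<lambda>t. sgn (f t) * g t)"
proof (rule weak_velocityI)
  have "set_borel_measurable borel {a<..<b} f" "set_borel_measurable borel {a<..<b} g"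
    using continuous_on_subset[OF f greaterThanLessThan_subseteq_atLeastAtMost_iff[THEN iffD2]] g
    by (auto intro: set_measurable_continuous_on)
  then have "(\<lambda>t. sgn (indicator {a<..<b} t *\<^sub>R f t) * (indicator {a<..<b} t *\<^sub>R g t))
      \<in> borel_measurable borel"
    unfolding set_borel_measurable_def sgn_if by measurable
  then show "set_borel_measurable borel {a<..<b} (\<lambda>t. sgn (f t) * g t)"
    unfolding set_borel_measurable_def
    by (rule measurable_cong[THEN iffD1, rotated]) (simp add: indicator_def)
  show "((\<lambda>t. sgn (f t) * g t) has_integral (\<bar>f t\<bar> - \<bar>f a\<bar>)) {a..t}" if "t \<in> {a..b}" for t
    by (rule has_integral_deriv_abs)
      (use that deriv continuous_on_subset[OF f] integrable_on_subinterval[OF integrable] in auto)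
  show "countable {t \<in> {a<..<b}. f t = 0 \<and> g t \<noteq> 0}"
    using deriv by (rule countable_transversal_zeros)
  show "((\<lambda>t. \<bar>f t\<bar>) has_vector_derivative sgn (f t) * g t) (at t)"
    if "t \<in> {a<..<b} - {t \<in> {a<..<b}. f t = 0 \<and> g t \<noteq> 0}" for t
    using has_real_derivative_abs[OF deriv, of t] that
    by (auto simp: has_real_derivative_iff_has_vector_derivative)
qed

lemma set_integrable_of_square:
  fixes g :: "'a \<Rightarrow> 'b::{banach, second_countable_topology}"
  assumes "A \<in> sets M" "emeasure M A < \<infinity>" "set_borel_measurable M A g"
    and square: "(\<integral>\<^sup>+x\<in>A. ennreal ((norm (g x))\<^sup>2) \<partial>M) < \<infinity>"
  shows "set_integrable M A g"
proof -
  let ?M = "restrict_space M A"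
  have A: "A \<inter> space M \<in> sets M" using assms(1) by auto
  have "emeasure ?M (space ?M) = emeasure M A"
    using assms(1) sets.sets_into_space[OF assms(1)]
    by (simp add: space_restrict_space2 emeasure_restrict_space[OF A])
  then interpret finite_measure ?M
    by (intro finite_measureI) (use assms(2) in simp)
  have [measurable]: "g \<in> borel_measurable ?M"
    using assms(3) by (simp add: set_borel_measurable_def borel_measurable_restrict_space_iff[OF A])
  have "integrable ?M (\<lambda>x. (norm (g x))\<^sup>2)"
    using square by (intro integrableI_nonneg) (simp_all add: nn_integral_restrict_space[OF A])
  then have "integrable ?M (\<lambda>x. norm (g x))"
    by (rule square_integrable_imp_integrable[rotated]) simp
  then have "integrable ?M g" by (simp add: integrable_norm_iff)
  then show ?thesis by (simp add: set_integrable_def integrable_restrict_space[OF A])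
qed

section \<open>Zeros of real functions and linear differential equations\<close>

lemma transversal_zero_levels:
  fixes f :: "real \<Rightarrow> real"
  assumes f: "continuous_on {a..b} f" and t: "a < t" "t < b"
    and zero: "(f has_real_derivative D) (at t)" "f t = 0" "D \<noteq> 0" and "0 < \<epsilon>"
  obtains p q c where "a < p" "p < t" "t < q" "q < b" "0 < c" "c < \<epsilon>" "\<bar>f p\<bar> = c" "\<bar>f q\<bar> = c"
proof -
  have nonzero: "\<forall>\<^sub>F s in at t. f s \<noteq> 0"
    by (rule eventually_nonzero_at_transversal_zero[OF zero])
  have "\<forall>\<^sub>F s in at_left t. f s \<noteq> 0 \<and> s \<in> {a<..<t}"
    using nonzero eventually_at_left_real[OF t(1)] by (simp add: eventually_at_split eventually_conj)
  from eventually_happens[OF this] obtain l where left: "f l \<noteq> 0" "a < l" "l < t"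
    by auto
  have "\<forall>\<^sub>F s in at_right t. f s \<noteq> 0 \<and> s \<in> {t<..<b}"
    using nonzero eventually_at_right_real[OF t(2)] by (simp add: eventually_at_split eventually_conj)
  from eventually_happens[OF this] obtain r where right: "f r \<noteq> 0" "t < r" "r < b"
    by auto
  define c where "c = min (min \<bar>f l\<bar> \<bar>f r\<bar>) \<epsilon> / 2"
  have level: "0 < c" "c < \<epsilon>" "c \<le> \<bar>f l\<bar>" "c \<le> \<bar>f r\<bar>"
    using left right \<open>0 < \<epsilon>\<close> by (auto simp: c_def)
  have abs_f: "continuous_on {x..y} (\<lambda>s. \<bar>f s\<bar>)" if "a \<le> x" "y \<le> b" for x y
    by (intro continuous_intros continuous_on_subset[OF f]) (use that in auto)
  obtain p where p: "l \<le> p" "p \<le> t" "\<bar>f p\<bar> = c"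
    using IVT2'[of "\<lambda>s. \<bar>f s\<bar>" t c l] level left t zero(2) abs_f[of l t] by auto
  obtain q where q: "t \<le> q" "q \<le> r" "\<bar>f q\<bar> = c"
    using IVT'[of "\<lambda>s. \<bar>f s\<bar>" t c r] level right t zero(2) abs_f[of t r] by auto
  have "p \<noteq> t" "q \<noteq> t" using p q level zero(2) by auto
  then show thesis using that[of p q c] p q level left right by auto
qed

lemma eventually_pos_right_of_double_zero:
  fixes f f' :: "real \<Rightarrow> real"
  assumes f: "\<And>t. t \<in> {a..<b} \<Longrightarrow> (f has_real_derivative f' t) (at t)"
    and f': "(f' has_real_derivative c) (at a)" and "0 < c" "a < b" and "f a = 0" "f' a = 0"
  shows "\<forall>\<^sub>F t in at_right a. 0 < f t"
proof -
  obtain d where "0 < d" and d: "\<And>h. 0 < h \<Longrightarrow> h < d \<Longrightarrow> f' a < f' (a + h)"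
    using DERIV_pos_inc_right[OF f' \<open>0 < c\<close>] by blast
  have "0 < f t" if t: "a < t" "t < min b (a + d)" for t
  proof -
    obtain s where s: "a < s" "s < t" "f t - f a = (t - a) * f' s"
      using MVT2[OF t(1), of f f'] f t by auto
    have "0 < f' s" using d[of "s - a"] s t \<open>f' a = 0\<close> by auto
    then show ?thesis using s t \<open>f a = 0\<close> by simp
  qed
  then show ?thesis
    unfolding eventually_at_right[OF \<open>a < b\<close>] using \<open>0 < d\<close> \<open>a < b\<close>
    by (intro exI[of _ "min b (a + d)"]) auto
qed

lemma eventually_pos_mult_right_of_double_zero:
  fixes f f' m :: "real \<Rightarrow> real"
  assumes f: "\<And>t. t \<in> {a..<b} \<Longrightarrow> (f has_real_derivative f' t) (at t)"
    and f': "(f' has_real_derivative \<gamma> * m a) (at a)" and m: "isCont m a" "m a \<noteq> 0"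
    and "0 < \<gamma>" "a < b" and "f a = 0" "f' a = 0"
  shows "\<forall>\<^sub>F t in at_right a. 0 < f t * m t"
proof -
  have "0 < m a * m a" using m(2) not_real_square_gt_zero by blast
  have "\<forall>\<^sub>F t in at_right a. 0 < m a * f t"
  proof (rule eventually_pos_right_of_double_zero)
    show "((\<lambda>t. m a * f' t) has_real_derivative m a * (\<gamma> * m a)) (at a)" by (rule DERIV_cmult[OF f'])
    show "0 < m a * (\<gamma> * m a)"
      using mult_pos_pos[OF \<open>0 < \<gamma>\<close> \<open>0 < m a * m a\<close>] by (simp only: mult.left_commute)
  qed (use assms in \<open>auto intro!: DERIV_cmult\<close>)
  moreover have "((\<lambda>t. m a * m t) \<longlongrightarrow> m a * m a) (at_right a)"
    using m(1) by (intro tendsto_intros) (simp add: isCont_def filterlim_at_split)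
  then have "\<forall>\<^sub>F t in at_right a. 0 < m a * m t"
    using \<open>0 < m a * m a\<close> by (rule order_tendstoD(1))
  ultimately show ?thesis
  proof eventually_elim
    case (elim t)
    then have "0 < (m a * f t) * (m a * m t)" by (rule mult_pos_pos)
    then have "0 < (m a)\<^sup>2 * (f t * m t)" by (simp add: power2_eq_square mult_ac)
    then show ?case using m(2) by (simp add: zero_less_mult_iff)
  qed
qed

lemma connected_nonzero_constant_sign:
  fixes f :: "'a::topological_space \<Rightarrow> real"
  assumes f: "continuous_on S f" and "connected S" and nonzero: "\<And>x. x \<in> S \<Longrightarrow> f x \<noteq> 0"
  shows "(\<forall>x\<in>S. 0 < f x) \<or> (\<forall>x\<in>S. f x < 0)"
proof (rule ccontr)
  assume "\<not> ?thesis"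
  then obtain x y where "x \<in> S" "f x \<le> 0" "y \<in> S" "0 \<le> f y" by force
  moreover have "connected (f ` S)" using f \<open>connected S\<close> by (rule connected_continuous_image)
  ultimately have "0 \<in> f ` S" by (meson connected_iff_interval imageI)
  with nonzero show False by auto
qed

lemma gronwall_nonpos:
  fixes E E' :: "real \<Rightarrow> real"
  assumes "a \<le> b" and E: "\<And>s. a \<le> s \<Longrightarrow> s \<le> b \<Longrightarrow> (E has_real_derivative E' s) (at s)"
    and growth: "\<And>s. a \<le> s \<Longrightarrow> s \<le> b \<Longrightarrow> E' s \<le> M * E s" and "E a \<le> 0"
  shows "E b \<le> 0"
proof -
  have "exp (- M * b) * E b \<le> exp (- M * a) * E a"
  proof (rule DERIV_nonpos_imp_nonincreasing[OF \<open>a \<le> b\<close>])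
    fix s assume s: "a \<le> s" "s \<le> b"
    have "((\<lambda>s. exp (- M * s) * E s) has_real_derivative exp (- M * s) * (E' s - M * E s)) (at s)"
      by (auto intro!: derivative_eq_intros E[OF s] simp: algebra_simps)
    moreover have "exp (- M * s) * (E' s - M * E s) \<le> 0"
      using growth[OF s] by (intro mult_nonneg_nonpos) auto
    ultimately show "\<exists>y. ((\<lambda>s. exp (- M * s) * E s) has_real_derivative y) (at s) \<and> y \<le> 0" by blast
  qed
  also have "\<dots> \<le> 0" using \<open>E a \<le> 0\<close> by (simp add: mult_le_0_iff)
  finally show ?thesis by (simp add: mult_le_0_iff)
qed

lemma gronwall_nonpos_segment:
  fixes E E' :: "real \<Rightarrow> real"
  assumes E: "\<And>s. s \<in> closed_segment a b \<Longrightarrow> (E has_real_derivative E' s) (at s)"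
    and growth: "\<And>s. s \<in> closed_segment a b \<Longrightarrow> \<bar>E' s\<bar> \<le> M * E s" and "E a \<le> 0"
  shows "E b \<le> 0"
proof (cases "a \<le> b")
  case True
  have "E' s \<le> M * E s" if "a \<le> s" "s \<le> b" for s
    using growth[of s] that True by (auto simp: closed_segment_eq_real_ivl)
  then show ?thesis
    using E True \<open>E a \<le> 0\<close> by (intro gronwall_nonpos[of a b E E']) (auto simp: closed_segment_eq_real_ivl)
next
  case False
  have "- E' (- s) \<le> M * E (- s)" if "- a \<le> s" "s \<le> - b" for s
    using growth[of "- s"] that False by (auto simp: closed_segment_eq_real_ivl)
  moreover have "((\<lambda>s. E (- s)) has_real_derivative - E' (- s)) (at s)" if "- a \<le> s" "s \<le> - b" for s
    using E[of "- s"] that False DERIV_mirror[of E "E' (- s)" s]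
    by (auto simp: closed_segment_eq_real_ivl)
  ultimately have "E (- (- b)) \<le> 0"
    using False \<open>E a \<le> 0\<close> by (intro gronwall_nonpos[of "- a" "- b" "\<lambda>s. E (- s)"]) auto
  then show ?thesis by simp
qed

lemma norm_derivative_le_imp_zero:
  fixes f f' :: "real \<Rightarrow> 'a::real_inner"
  assumes "convex S" and f: "\<And>t. t \<in> S \<Longrightarrow> (f has_vector_derivative f' t) (at t)"
    and C: "continuous_on S C" and growth: "\<And>t. t \<in> S \<Longrightarrow> norm (f' t) \<le> C t * norm (f t)"
    and "t0 \<in> S" "f t0 = 0" and "t \<in> S"
  shows "f t = 0"
proof -
  have segment: "closed_segment t0 t \<subseteq> S" using assms by (simp add: closed_segment_subset)
  have "compact (C ` closed_segment t0 t)"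
    by (rule compact_continuous_image[OF continuous_on_subset[OF C segment] compact_segment])
  then have "bdd_above (C ` closed_segment t0 t)"
    by (rule bounded_imp_bdd_above[OF compact_imp_bounded])
  then obtain M where M: "\<And>s. s \<in> closed_segment t0 t \<Longrightarrow> C s \<le> M"
    by (auto simp: bdd_above_def)
  define E where "E s = f s \<bullet> f s" for s
  define E' where "E' s = 2 * (f s \<bullet> f' s)" for s
  have E: "(E has_real_derivative E' s) (at s)" if "s \<in> closed_segment t0 t" for s
  proof -
    have "(f has_vector_derivative f' s) (at s)" using f that segment by blast
    from bounded_bilinear.has_vector_derivative[OF bounded_bilinear_inner this this]
    show ?thesis
      unfolding E_def E'_def has_real_derivative_iff_has_vector_derivative
      by (simp add: inner_commute[of "f' s"])
  qed
  have E_growth: "\<bar>E' s\<bar> \<le> (2 * M) * E s" if s: "s \<in> closed_segment t0 t" for s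
  proof -
    have "norm (f' s) \<le> M * norm (f s)"
      using growth[of s] M[OF s] s segment by (meson mult_right_mono norm_ge_zero order_trans subsetD)
    then have "norm (f s) * norm (f' s) \<le> norm (f s) * (M * norm (f s))"
      by (rule mult_left_mono) simp
    then have "\<bar>f s \<bullet> f' s\<bar> \<le> M * (f s \<bullet> f s)"
      using Cauchy_Schwarz_ineq2[of "f s" "f' s"]
      by (simp add: power2_norm_eq_inner[symmetric] power2_eq_square mult_ac)
    then show ?thesis by (simp add: E_def E'_def abs_mult)
  qed
  have "E t0 \<le> 0" using \<open>f t0 = 0\<close> by (simp add: E_def)
  with E E_growth have "E t \<le> 0" by (rule gronwall_nonpos_segment)
  then show ?thesis unfolding E_def by (metis inner_ge_zero inner_eq_zero_iff order_antisym)
qed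

lemma linear_second_order_ode_zero:
  fixes f f' f'' :: "real \<Rightarrow> 'a::real_inner"
  assumes "convex S"
    and f: "\<And>t. t \<in> S \<Longrightarrow> (f has_vector_derivative f' t) (at t)"
    and f': "\<And>t. t \<in> S \<Longrightarrow> (f' has_vector_derivative f'' t) (at t)"
    and C: "continuous_on S C" and growth: "\<And>t. t \<in> S \<Longrightarrow> norm (f'' t) \<le> C t * norm (f t)"
    and zero: "t0 \<in> S" "f t0 = 0" "f' t0 = 0" and "t \<in> S"
  shows "f t = 0"
proof -
  have "(f t, f' t) = 0"
  proof (rule norm_derivative_le_imp_zero[OF \<open>convex S\<close>])
    show "((\<lambda>t. (f t, f' t)) has_vector_derivative (f' t, f'' t)) (at t)" if "t \<in> S" for t
      using that by (intro has_vector_derivative_Pair f f')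
    show "continuous_on S (\<lambda>t. 1 + \<bar>C t\<bar>)" by (intro continuous_intros C)
    show "norm (f' t, f'' t) \<le> (1 + \<bar>C t\<bar>) * norm (f t, f' t)" if "t \<in> S" for t
    proof -
      have "norm (f' t, f'' t) \<le> norm (f' t) + norm (f'' t)" by (rule norm_Pair_le)
      also have "\<dots> \<le> norm (f t, f' t) + \<bar>C t\<bar> * norm (f t, f' t)"
      proof (intro add_mono)
        show "norm (f' t) \<le> norm (f t, f' t)" using norm_snd_le[of "f' t" "f t"] by simp
        have "norm (f'' t) \<le> \<bar>C t\<bar> * norm (f t)"
          using growth[OF that] by (meson abs_ge_self mult_right_mono norm_ge_zero order_trans)
        also have "\<dots> \<le> \<bar>C t\<bar> * norm (f t, f' t)"
          using norm_fst_le[of "f t" "f' t"] by (intro mult_left_mono) auto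
        finally show "norm (f'' t) \<le> \<bar>C t\<bar> * norm (f t, f' t)" .
      qed
      finally show ?thesis by (simp add: algebra_simps)
    qed
  qed (use zero \<open>t \<in> S\<close> in \<open>auto simp: zero_prod_def\<close>)
  then show ?thesis by (simp add: zero_prod_def)
qed

lemma norm_linear_pair_le:
  fixes a b c d x y :: real
  shows "norm (a * x + b * y, c * x + d * y) \<le> (\<bar>a\<bar> + \<bar>b\<bar> + \<bar>c\<bar> + \<bar>d\<bar>) * norm (x, y)"
proof -
  have "\<bar>r * x + s * y\<bar> \<le> (\<bar>r\<bar> + \<bar>s\<bar>) * norm (x, y)" for r s
  proof -
    have "\<bar>r * x + s * y\<bar> \<le> \<bar>r\<bar> * \<bar>x\<bar> + \<bar>s\<bar> * \<bar>y\<bar>"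
      using abs_triangle_ineq[of "r * x" "s * y"] by (simp add: abs_mult)
    also have "\<dots> \<le> \<bar>r\<bar> * norm (x, y) + \<bar>s\<bar> * norm (x, y)"
      using norm_fst_le[of x y] norm_snd_le[of y x] by (intro add_mono mult_left_mono) auto
    finally show ?thesis by (simp add: algebra_simps)
  qed
  from this[of a b] this[of c d] show ?thesis
    using norm_Pair_le[of "a * x + b * y" "c * x + d * y"] by (simp add: algebra_simps)
qed

lemma linear_ode_pair_zero:
  fixes f g f' g' a b c d :: "real \<Rightarrow> real"
  assumes "convex S"
    and fg: "\<And>t. t \<in> S \<Longrightarrow> (f has_real_derivative f' t) (at t)"
      "\<And>t. t \<in> S \<Longrightarrow> (g has_real_derivative g' t) (at t)"
      "\<And>t. t \<in> S \<Longrightarrow> (f' has_real_derivative a t * f t + b t * g t) (at t)"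
      "\<And>t. t \<in> S \<Longrightarrow> (g' has_real_derivative c t * f t + d t * g t) (at t)"
    and "continuous_on S a" "continuous_on S b" "continuous_on S c" "continuous_on S d"
    and "t0 \<in> S" "f t0 = 0" "g t0 = 0" "f' t0 = 0" "g' t0 = 0" and "t \<in> S"
  shows "f t = 0 \<and> g t = 0"
proof -
  have "(f t, g t) = 0"
  proof (rule linear_second_order_ode_zero[OF \<open>convex S\<close>, where f = "\<lambda>t. (f t, g t)" and ?t0.0 = t0])
    show "((\<lambda>t. (f t, g t)) has_vector_derivative (f' t, g' t)) (at t)"
      "((\<lambda>t. (f' t, g' t)) has_vector_derivative (a t * f t + b t * g t, c t * f t + d t * g t)) (at t)"
      if "t \<in> S" for t
      using fg[OF that]
      by (auto intro: has_vector_derivative_Pair simp: has_real_derivative_iff_has_vector_derivative)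
    show "continuous_on S (\<lambda>t. \<bar>a t\<bar> + \<bar>b t\<bar> + \<bar>c t\<bar> + \<bar>d t\<bar>)"
      by (intro continuous_intros assms)
  qed (use assms norm_linear_pair_le in \<open>auto simp: zero_prod_def\<close>)
  then show ?thesis by (simp add: zero_prod_def)
qed

section \<open>The action in Jacobi coordinates\<close>

text \<open>The pair $(Z_1, Z_2)$ of Jacobi coordinates.\<close>
type_synonym config = "pt \<times> pt"

definition jacobi :: "pt \<Rightarrow> pt \<Rightarrow> pt \<Rightarrow> config" where
  "jacobi x1 x2 x3 = (x1 - x2, x3 - (1/2) *\<^sub>R (x1 + x2))"

definition body1 :: "config \<Rightarrow> pt" where
  "body1 u = (1/2) *\<^sub>R fst u - (1/3) *\<^sub>R snd u"

definition body2 :: "config \<Rightarrow> pt" where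
  "body2 u = - (1/2) *\<^sub>R fst u - (1/3) *\<^sub>R snd u"

definition body3 :: "config \<Rightarrow> pt" where
  "body3 u = (2/3) *\<^sub>R snd u"

definition dist12 :: "config \<Rightarrow> real" where
  "dist12 u = norm (fst u)"

definition dist13 :: "config \<Rightarrow> real" where
  "dist13 u = norm (snd u - (1/2) *\<^sub>R fst u)"

definition dist23 :: "config \<Rightarrow> real" where
  "dist23 u = norm (snd u + (1/2) *\<^sub>R fst u)"

definition collision_free :: "config \<Rightarrow> bool" where
  "collision_free u \<longleftrightarrow> 0 < dist12 u \<and> 0 < dist13 u \<and> 0 < dist23 u"

definition potential :: "config \<Rightarrow> real" where
  "potential u = 1 / dist12 u + 1 / dist13 u + 1 / dist23 u"

definition kinetic :: "config \<Rightarrow> real" where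
  "kinetic e = (norm (fst e))\<^sup>2 / 4 + (norm (snd e))\<^sup>2 / 3"

definition lagrangian :: "config \<Rightarrow> config \<Rightarrow> real" where
  "lagrangian u e = kinetic e + potential u"

definition lagrangian_action :: "(real \<Rightarrow> config) \<Rightarrow> (real \<Rightarrow> config) \<Rightarrow> ennreal" where
  "lagrangian_action u d = (\<integral>\<^sup>+t\<in>{0<..<1}. ennreal (lagrangian (u t) (d t)) \<partial>lborel)"

definition start_config :: "config \<Rightarrow> bool" where
  "start_config u \<longleftrightarrow> fst u = 0 \<and> 0 \<le> fst (snd u) \<and> snd (snd u) = 0"

definition end_config :: "config \<Rightarrow> bool" where
  "end_config u \<longleftrightarrow> fst (snd u) = 3/2 * fst (fst u) \<and> snd (snd u) = - snd (fst u) / 2"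

definition competitor :: "(real \<Rightarrow> config) \<Rightarrow> (real \<Rightarrow> config) \<Rightarrow> bool" where
  "competitor u d \<longleftrightarrow> weak_velocity 0 1 u d \<and> (\<forall>t\<in>{0<..<1}. collision_free (u t)) \<and>
     start_config (u 0) \<and> end_config (u 1)"

lemma dist_nonneg [simp]: "0 \<le> dist12 u" "0 \<le> dist13 u" "0 \<le> dist23 u"
  by (simp_all add: dist12_def dist13_def dist23_def)

lemma potential_nonneg: "0 \<le> potential u"
  by (simp add: potential_def)

lemma kinetic_nonneg: "0 \<le> kinetic e"
  by (simp add: kinetic_def)

lemma lagrangian_nonneg: "0 \<le> lagrangian u e"
  by (simp add: lagrangian_def kinetic_nonneg potential_nonneg)

lemma bodies_jacobi:
  assumes "x1 + x2 + x3 = 0"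
  shows "body1 (jacobi x1 x2 x3) = x1" "body2 (jacobi x1 x2 x3) = x2" "body3 (jacobi x1 x2 x3) = x3"
proof -
  have "x3 = - x1 - x2" using assms by (simp add: eq_neg_iff_add_eq_0 add_ac algebra_simps)
  then show "body1 (jacobi x1 x2 x3) = x1" "body2 (jacobi x1 x2 x3) = x2" "body3 (jacobi x1 x2 x3) = x3"
    by (auto simp: body1_def body2_def body3_def jacobi_def prod_eq_iff field_simps)
qed

lemma sum_bodies: "body1 u + body2 u + body3 u = 0"
  by (auto simp: body1_def body2_def body3_def prod_eq_iff)

lemma jacobi_bodies: "jacobi (body1 u) (body2 u) (body3 u) = u"
  by (auto simp: jacobi_def body1_def body2_def body3_def prod_eq_iff field_simps)

lemma bounded_linear_bodies:
  "bounded_linear body1" "bounded_linear body2" "bounded_linear body3"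
  unfolding body1_def body2_def body3_def
  by (intro bounded_linear_sub bounded_linear_scaleR_right[THEN bounded_linear_compose]
      bounded_linear_fst bounded_linear_snd)+

lemma diff_bodies:
  "body1 u - body2 u = fst u" "body3 u - body1 u = snd u - (1/2) *\<^sub>R fst u"
  "body3 u - body2 u = snd u + (1/2) *\<^sub>R fst u"
  by (simp_all add: body1_def body2_def body3_def prod_eq_iff field_simps)

lemma dist_bodies:
  "dist (body1 u) (body2 u) = dist12 u" "dist (body1 u) (body3 u) = dist13 u"
  "dist (body2 u) (body3 u) = dist23 u"
  by (simp_all add: dist12_def dist13_def dist23_def dist_norm diff_bodies
      norm_minus_commute[of _ "body3 u"])

lemma collision_free_iff_bodies:
  "collision_free u \<longleftrightarrow> body1 u \<noteq> body2 u \<and> body1 u \<noteq> body3 u \<and> body2 u \<noteq> body3 u"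
  by (simp add: collision_free_def dist_bodies[symmetric])

lemma start_config_iff_bodies: "start_config u \<longleftrightarrow> in_Q_S4 (body1 u) (body2 u) (body3 u)"
proof
  assume "start_config u"
  then show "in_Q_S4 (body1 u) (body2 u) (body3 u)"
    unfolding in_Q_S4_def start_config_def body1_def body2_def body3_def
    by (intro exI[of _ "fst (snd u) / 3"]) (auto simp: prod_eq_iff)
next
  assume "in_Q_S4 (body1 u) (body2 u) (body3 u)"
  then obtain a where "0 \<le> a" and "body1 u = (-a, 0)" "body2 u = (-a, 0)" "body3 u = (2*a, 0)"
    unfolding in_Q_S4_def by blast
  then have "u = jacobi (-a, 0) (-a, 0) (2*a, 0)"
    using jacobi_bodies[of u] by simp
  with \<open>0 \<le> a\<close> show "start_config u"
    by (simp add: start_config_def jacobi_def zero_prod_def)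
qed

lemma end_config_iff_bodies: "end_config u \<longleftrightarrow> in_Q_E1 (body1 u) (body2 u) (body3 u)"
proof
  assume "end_config u"
  then show "in_Q_E1 (body1 u) (body2 u) (body3 u)"
    unfolding in_Q_E1_def end_config_def body1_def body2_def body3_def
    by (intro exI[of _ "snd (snd u) * (2/3)"] exI[of _ "fst (fst u)"])
      (auto simp: prod_eq_iff field_simps)
next
  assume "in_Q_E1 (body1 u) (body2 u) (body3 u)"
  then obtain b1 b2 where "body1 u = (0, -2*b1)" "body2 u = (-b2, b1)" "body3 u = (b2, b1)"
    unfolding in_Q_E1_def by blast
  then have "u = jacobi (0, -2*b1) (-b2, b1) (b2, b1)"
    using jacobi_bodies[of u] by simp
  then show "end_config u" by (simp add: end_config_def jacobi_def)
qed

lemma kinetic_bodies: "((norm (body1 e))\<^sup>2 + (norm (body2 e))\<^sup>2 + (norm (body3 e))\<^sup>2) / 2 = kinetic e"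
  unfolding kinetic_def power2_norm_eq_inner body1_def body2_def body3_def
  by (simp add: inner_commute[of "snd e" "fst e"] algebra_simps)

lemma potential_bodies:
  assumes "collision_free u"
  shows "inv_dist (body1 u) (body2 u) + inv_dist (body1 u) (body3 u) + inv_dist (body2 u) (body3 u)
    = ennreal (potential u)"
  using assms by (simp add: collision_free_iff_bodies inv_dist_def potential_def dist_bodies ennreal_plus)

lemma vector_derivative_bounded_linear:
  assumes L: "bounded_linear L" and u: "(u has_vector_derivative d) (at t)"
    and S: "open S" "t \<in> S" and p: "\<And>s. s \<in> S \<Longrightarrow> p s = L (u s)"
  shows "vector_derivative p (at t) = L d"
proof (rule vector_derivative_at, rule has_vector_derivative_transform_within_open)
  show "((\<lambda>s. L (u s)) has_vector_derivative L d) (at t)"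
    by (rule bounded_linear.has_vector_derivative[OF L u])
  show "L (u s) = p s" if "s \<in> S" for s using p[OF that] by simp
qed (use S in auto)

lemma action_eq_lagrangian_action:
  assumes "countable K" and deriv: "\<And>t. t \<in> {0<..<1} - K \<Longrightarrow> (u has_vector_derivative d t) (at t)"
    and bodies: "\<And>t. t \<in> {0<..<1} \<Longrightarrow> p1 t = body1 (u t) \<and> p2 t = body2 (u t) \<and> p3 t = body3 (u t)"
    and free: "\<And>t. t \<in> {0<..<1} \<Longrightarrow> collision_free (u t)"
  shows "action p1 p2 p3 = lagrangian_action u d"
  unfolding action_def lagrangian_action_def
proof (rule nn_integral_cong_AE)
  have "AE t in lborel. t \<notin> K \<union> {0,1}"
    by (rule AE_not_in) (use \<open>countable K\<close> in \<open>auto intro!: countable_imp_null_set_lborel\<close>)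
  then show "AE t in lborel.
      (ennreal (((norm (vector_derivative p1 (at t)))\<^sup>2 + (norm (vector_derivative p2 (at t)))\<^sup>2
          + (norm (vector_derivative p3 (at t)))\<^sup>2) / 2)
        + inv_dist (p1 t) (p2 t) + inv_dist (p1 t) (p3 t) + inv_dist (p2 t) (p3 t)) * indicator {0..1} t
      = ennreal (lagrangian (u t) (d t)) * indicator {0<..<1} t"
  proof eventually_elim
    case (elim t)
    show ?case
    proof (cases "t \<in> {0<..<1}")
      case t: True
      have deriv_t: "(u has_vector_derivative d t) (at t)" using deriv[of t] t elim by auto
      note velocity = bounded_linear_bodies[THEN vector_derivative_bounded_linear, OF deriv_t, of "{0<..<1}"]
      have "vector_derivative p1 (at t) = body1 (d t)" "vector_derivative p2 (at t) = body2 (d t)"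
        "vector_derivative p3 (at t) = body3 (d t)"
        using t bodies by (auto intro!: velocity)
      then show ?thesis
        using t bodies[OF t] potential_bodies[OF free[OF t]] kinetic_bodies[of "d t"]
        by (simp only:) (simp add: lagrangian_def kinetic_nonneg potential_nonneg add.assoc)
    qed (use elim in auto)
  qed
qed

lemma H1_path_continuous_on:
  assumes "H1_path f"
  shows "continuous_on {0..1} f"
proof -
  obtain g where g: "set_integrable lborel {0..1} g"
    and f: "\<And>t. t \<in> {0..1} \<Longrightarrow> f t = f 0 + (LINT s:{0..t}|lborel. g s)"
    using assms unfolding H1_path_def by blast
  show ?thesis
  proof (rule continuous_on_eq)
    show "continuous_on {0..1} (\<lambda>t. f 0 + integral {0..t} g)"
      using set_borel_integral_eq_integral(1)[OF g]
      by (intro continuous_intros indefinite_integral_continuous_1)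
    show "f 0 + integral {0..t} g = f t" if t: "t \<in> {0..1}" for t
    proof -
      have "set_integrable lborel {0..t} g" by (rule set_integrable_subset[OF g]) (use t in auto)
      then show ?thesis using f[OF t] set_borel_integral_eq_integral(2)[of "{0..t}" g] by simp
    qed
  qed
qed

lemma H1_path_weak_velocity:
  assumes fg: "weak_velocity 0 1 f g"
    and square: "(\<integral>\<^sup>+t\<in>{0<..<1}. ennreal ((norm (g t))\<^sup>2) \<partial>lborel) < \<infinity>"
  shows "H1_path f"
  unfolding H1_path_def
proof (intro exI[of _ "\<lambda>t. indicator {0<..<1} t *\<^sub>R g t"] conjI ballI)
  let ?g = "\<lambda>t. indicator {0<..<1} t *\<^sub>R g t"
  show "?g \<in> borel_measurable lborel"
    using weak_velocity_measurable[OF fg] by (simp add: set_borel_measurable_def)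
  then have restricted: "set_borel_measurable lborel {0..1} ?g"
    unfolding set_borel_measurable_def by (rule borel_measurable_scaleR[rotated]) simp
  have "(\<integral>\<^sup>+t\<in>{0..1}. ennreal ((norm (?g t))\<^sup>2) \<partial>lborel)
      = (\<integral>\<^sup>+t\<in>{0<..<1}. ennreal ((norm (g t))\<^sup>2) \<partial>lborel)"
    by (intro nn_integral_cong) (auto simp: indicator_def)
  with square show finite: "(\<integral>\<^sup>+t\<in>{0..1}. ennreal ((norm (?g t))\<^sup>2) \<partial>lborel) < \<infinity>" by simp
  show integrable: "set_integrable lborel {0..1} ?g"
    using restricted finite by (intro set_integrable_of_square) auto
  show "f t = f 0 + (LINT s:{0..t}|lborel. ?g s)" if t: "t \<in> {0..1}" for t
  proof -
    have "(?g has_integral (f t - f 0)) {0..t}"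
      by (rule has_integral_spike_finite[of "{0, 1}"])
        (use t weak_velocity_has_integral[OF fg, of 0 t] in auto)
    moreover have "set_integrable lborel {0..t} ?g"
      by (rule set_integrable_subset[OF integrable]) (use t in auto)
    ultimately show ?thesis
      by (simp add: set_borel_integral_eq_integral(2) integral_unique)
  qed
qed

lemma lagrangian_measurable:
  assumes "weak_velocity 0 1 u d"
  shows "(\<lambda>t. ennreal (lagrangian (u t) (d t)) * indicator {0<..<1} t) \<in> borel_measurable borel"
proof -
  have [measurable]: "fst \<in> borel_measurable (borel :: config measure)"
    "snd \<in> borel_measurable (borel :: config measure)"
    by (intro borel_measurable_continuous_onI continuous_intros)+
  let ?restrict = "\<lambda>f t. indicator {0<..<1::real} t *\<^sub>R (f t :: config)"
  have "continuous_on {0<..<1} u"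
    by (rule continuous_on_subset[OF weak_velocity_continuous_on[OF assms]]) auto
  then have [measurable]: "?restrict u \<in> borel_measurable borel" "?restrict d \<in> borel_measurable borel"
    using set_measurable_continuous_on[of "{0<..<1}" u] weak_velocity_measurable[OF assms]
    by (simp_all add: set_borel_measurable_def)
  have "(\<lambda>t. ennreal (lagrangian (?restrict u t) (?restrict d t)) * indicator {0<..<1} t)
      \<in> borel_measurable borel"
    unfolding lagrangian_def kinetic_def potential_def dist12_def dist13_def dist23_def by measurable
  also have "(\<lambda>t. ennreal (lagrangian (?restrict u t) (?restrict d t)) * indicator {0<..<1} t)
      = (\<lambda>t. ennreal (lagrangian (u t) (d t)) * indicator {0<..<1} t)"
    by (auto simp: fun_eq_iff indicator_def)
  finally show ?thesis .
qed

lemma finite_action_imp_finite_velocity_integral: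
  assumes ud: "weak_velocity 0 1 u d" and finite: "lagrangian_action u d < \<infinity>"
    and bound: "\<And>e. f e \<le> C * kinetic e" and "0 \<le> C"
  shows "(\<integral>\<^sup>+t\<in>{0<..<1}. ennreal (f (d t)) \<partial>lborel) < \<infinity>"
proof -
  have "ennreal (f (d t)) \<le> ennreal C * ennreal (lagrangian (u t) (d t))" for t
  proof -
    have "C * kinetic (d t) \<le> C * lagrangian (u t) (d t)"
      using \<open>0 \<le> C\<close> potential_nonneg[of "u t"] by (intro mult_left_mono) (simp_all add: lagrangian_def)
    then have "f (d t) \<le> C * lagrangian (u t) (d t)" using bound[of "d t"] by linarith
    then show ?thesis using \<open>0 \<le> C\<close> by (metis ennreal_leI ennreal_mult lagrangian_nonneg)
  qed
  then have "(\<integral>\<^sup>+t\<in>{0<..<1}. ennreal (f (d t)) \<partial>lborel)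
      \<le> (\<integral>\<^sup>+t. ennreal C * (ennreal (lagrangian (u t) (d t)) * indicator {0<..<1} t) \<partial>lborel)"
    by (intro nn_integral_mono) (simp add: indicator_def)
  also have "\<dots> = ennreal C * lagrangian_action u d"
    unfolding lagrangian_action_def using lagrangian_measurable[OF ud] by (intro nn_integral_cmult) simp
  also have "\<dots> < \<infinity>" using finite by (simp add: ennreal_mult_less_top)
  finally show ?thesis .
qed

lemma competitor_imp_admissible:
  assumes ud: "competitor u d" and finite: "lagrangian_action u d < \<infinity>"
  shows "admissible (\<lambda>t. body1 (u t)) (\<lambda>t. body2 (u t)) (\<lambda>t. body3 (u t))"
proof -
  have weak: "weak_velocity 0 1 u d" using ud by (simp add: competitor_def)
  have H1: "H1_path (\<lambda>t. L (u t))"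
    if "bounded_linear L" "\<And>e. (norm (L e))\<^sup>2 \<le> 4 * kinetic e" for L :: "config \<Rightarrow> pt"
    using that by (intro H1_path_weak_velocity[OF weak_velocity_linear[OF weak]]
        finite_action_imp_finite_velocity_integral[OF weak finite, where C = 4]) simp_all
  have "(norm (body1 e))\<^sup>2 \<le> 4 * kinetic e" "(norm (body2 e))\<^sup>2 \<le> 4 * kinetic e"
    "(norm (body3 e))\<^sup>2 \<le> 4 * kinetic e" for e
    unfolding kinetic_bodies[symmetric] by simp_all
  then show ?thesis
    using ud unfolding admissible_def competitor_def
    by (simp add: H1 bounded_linear_bodies sum_bodies start_config_iff_bodies end_config_iff_bodies)
qed

lemma minimizer_action_le:
  assumes minimizer: "minimizer q1 q2 q3" and ud: "competitor u d"
  shows "action q1 q2 q3 \<le> lagrangian_action u d"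
proof (cases "lagrangian_action u d < \<infinity>")
  case True
  have "weak_velocity 0 1 u d" using ud by (simp add: competitor_def)
  then obtain K where K: "countable K" "\<And>t. t \<in> {0<..<1} - K \<Longrightarrow> (u has_vector_derivative d t) (at t)"
    by (rule weak_velocityE) blast
  have "action (\<lambda>t. body1 (u t)) (\<lambda>t. body2 (u t)) (\<lambda>t. body3 (u t)) = lagrangian_action u d"
    using ud by (intro action_eq_lagrangian_action[OF K]) (auto simp: competitor_def)
  then show ?thesis
    using minimizer competitor_imp_admissible[OF ud True] unfolding minimizer_def by metis
qed (simp add: less_top[symmetric])

text \<open>The exponent 2/3 is that of a binary collision: both the squared speed and the
  potential are then of order $t^{-2/3}$.\<close>
definition collision_path :: "real \<Rightarrow> config" where
  "collision_path t = ((t powr (2/3), 0), (3/2, 0))"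

definition collision_path_velocity :: "real \<Rightarrow> config" where
  "collision_path_velocity t = ((2/3 * t powr (-1/3), 0), (0, 0))"

lemma dist_collision_path:
  assumes t: "t \<in> {0<..<1}"
  shows "dist12 (collision_path t) = t powr (2/3)" "dist13 (collision_path t) = 3/2 - t powr (2/3) / 2"
    "dist23 (collision_path t) = 3/2 + t powr (2/3) / 2" "0 < t powr (2/3)" "t powr (2/3) < 1"
proof -
  show "0 < t powr (2/3)" using t by simp
  show "t powr (2/3) < 1" using powr_less_mono2[of "2/3" t 1] t by simp
  then show "dist12 (collision_path t) = t powr (2/3)" "dist13 (collision_path t) = 3/2 - t powr (2/3) / 2"
    "dist23 (collision_path t) = 3/2 + t powr (2/3) / 2"
    by (simp_all add: dist12_def dist13_def dist23_def collision_path_def norm_Pair)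
qed

lemma competitor_collision_path: "competitor collision_path collision_path_velocity"
proof -
  have "weak_velocity 0 1 collision_path collision_path_velocity"
    unfolding collision_path_def collision_path_velocity_def
  proof (rule weak_velocity_differentiable)
    fix t :: real assume t: "t \<in> {0<..<1}"
    have "((\<lambda>t. t powr (2/3)) has_real_derivative 2/3 * t powr (-1/3)) (at t)"
      using t by (auto intro!: derivative_eq_intros)
    then show "((\<lambda>t. ((t powr (2/3), 0), (3/2, 0))) has_vector_derivative
        ((2/3 * t powr (-1/3), 0), (0, 0))) (at t)"
      unfolding has_real_derivative_iff_has_vector_derivative
      by (intro has_vector_derivative_Pair has_vector_derivative_const)
  qed (auto intro!: continuous_intros continuous_on_powr')
  moreover have "collision_free (collision_path t)" if "t \<in> {0<..<1}" for t
    unfolding collision_free_def dist_collision_path(1-3)[OF that]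
    using dist_collision_path(4,5)[OF that] by linarith
  ultimately show ?thesis
    by (simp add: competitor_def start_config_def end_config_def collision_path_def zero_prod_def)
qed

lemma lagrangian_collision_path_le:
  assumes t: "t \<in> {0<..<1}"
  shows "lagrangian (collision_path t) (collision_path_velocity t) \<le> 2 * t powr (-2/3) + 2"
proof -
  note dist = dist_collision_path[OF t]
  have "kinetic (collision_path_velocity t) = 1/9 * t powr (-2/3)"
    by (simp add: kinetic_def collision_path_velocity_def norm_Pair power2_eq_square powr_add[symmetric])
  moreover have "potential (collision_path t)
      = t powr (-2/3) + 1 / (3/2 - t powr (2/3) / 2) + 1 / (3/2 + t powr (2/3) / 2)"
    using t by (simp add: potential_def dist(1-3) powr_minus_divide)
  moreover have "1 / (3/2 - s / 2) \<le> 1" "1 / (3/2 + s / 2) \<le> 1" if "0 < s" "s < 1" for s :: real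
    using that by (simp_all add: divide_le_eq)
  note this[OF dist(4,5)]
  moreover have "0 \<le> t powr (-2/3)" by simp
  ultimately show ?thesis unfolding lagrangian_def by linarith
qed

lemma minimizer_action_finite:
  assumes "minimizer q1 q2 q3"
  shows "action q1 q2 q3 < \<infinity>"
proof -
  let ?bound = "\<lambda>t::real. 2 * t powr (-2/3) + 2"
  have "action q1 q2 q3 \<le> lagrangian_action collision_path collision_path_velocity"
    by (rule minimizer_action_le[OF assms competitor_collision_path])
  also have "\<dots> \<le> (\<integral>\<^sup>+t\<in>{0..1}. ennreal (?bound t) \<partial>lborel)"
    unfolding lagrangian_action_def
    by (intro nn_integral_mono)
      (use lagrangian_collision_path_le in
        \<open>auto simp: indicator_def simp del: ennreal_plus intro!: ennreal_leI\<close>)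
  also have "\<dots> < \<infinity>"
  proof -
    have "(\<lambda>t::real. t powr (-2/3)) integrable_on {0..1}"
      by (rule integrable_on_powr_from_0) auto
    then have "?bound integrable_on {0..1}"
      by (intro integrable_add integrable_on_mult_right integrable_const_ivl) simp
    then have "(\<integral>\<^sup>+t\<in>{0..1}. ennreal (?bound t) \<partial>lborel) = ennreal (integral {0..1} ?bound)"
      by (intro nn_integral_has_integral_lebesgue' integrable_integral) auto
    then show ?thesis by simp
  qed
  finally show ?thesis .
qed

section \<open>Reflection into the quadrants\<close>

lemma inverse_sqrt_pair_square:
  fixes A x :: real
  assumes "\<bar>x\<bar> < A"
  shows "(1 / sqrt (A - x) + 1 / sqrt (A + x))\<^sup>2 = 2 * A / (A\<^sup>2 - x\<^sup>2) + 2 / sqrt (A\<^sup>2 - x\<^sup>2)"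
proof -
  have pos: "0 < A - x" "0 < A + x" using assms by auto
  have factor: "A\<^sup>2 - x\<^sup>2 = (A - x) * (A + x)" by (simp add: power2_eq_square algebra_simps)
  have "(1 / sqrt (A - x) + 1 / sqrt (A + x))\<^sup>2
      = 1 / (A - x) + 1 / (A + x) + 2 / (sqrt (A - x) * sqrt (A + x))"
    using pos by (simp add: power2_sum power_divide)
  also have "1 / (A - x) + 1 / (A + x) = 2 * A / ((A - x) * (A + x))"
    using pos by (simp add: field_simps)
  finally show ?thesis unfolding factor by (simp add: real_sqrt_mult)
qed

lemma inverse_sqrt_pair_less:
  fixes A x y :: real
  assumes "\<bar>x\<bar> < A" "\<bar>y\<bar> < \<bar>x\<bar>"
  shows "1 / sqrt (A - y) + 1 / sqrt (A + y) < 1 / sqrt (A - x) + 1 / sqrt (A + x)"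
    (is "?g y < ?g x")
proof (rule power2_less_imp_less)
  have "0 < A" "\<bar>y\<bar> < A" using assms by auto
  have "0 < A\<^sup>2 - x\<^sup>2" "A\<^sup>2 - x\<^sup>2 < A\<^sup>2 - y\<^sup>2"
    using power_strict_mono[of "\<bar>x\<bar>" A 2] power_strict_mono[of "\<bar>y\<bar>" "\<bar>x\<bar>" 2] assms by auto
  then show "(?g y)\<^sup>2 < (?g x)\<^sup>2"
    unfolding inverse_sqrt_pair_square[OF assms(1)] inverse_sqrt_pair_square[OF \<open>\<bar>y\<bar> < A\<close>]
    using \<open>0 < A\<close> by (intro add_strict_mono divide_strict_left_mono mult_pos_pos) auto
  show "0 \<le> ?g x" using assms(1) by (intro add_nonneg_nonneg) auto
qed

lemma dist13_square: "(dist13 u)\<^sup>2 = (norm (snd u))\<^sup>2 + (norm (fst u))\<^sup>2 / 4 - fst u \<bullet> snd u"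
  and dist23_square: "(dist23 u)\<^sup>2 = (norm (snd u))\<^sup>2 + (norm (fst u))\<^sup>2 / 4 + fst u \<bullet> snd u"
  unfolding dist13_def dist23_def power2_norm_eq_inner
  by (simp_all add: inner_commute algebra_simps)

lemma potential_eq_inverse_sqrt_pair:
  "potential u = 1 / norm (fst u)
    + (1 / sqrt ((norm (snd u))\<^sup>2 + (norm (fst u))\<^sup>2 / 4 - fst u \<bullet> snd u)
      + 1 / sqrt ((norm (snd u))\<^sup>2 + (norm (fst u))\<^sup>2 / 4 + fst u \<bullet> snd u))"
  unfolding dist13_square[symmetric] dist23_square[symmetric] potential_def dist12_def by simp

lemma collision_free_iff_inner:
  "collision_free u \<longleftrightarrow>
    0 < norm (fst u) \<and> \<bar>fst u \<bullet> snd u\<bar> < (norm (snd u))\<^sup>2 + (norm (fst u))\<^sup>2 / 4"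
proof -
  have "0 < dist13 u \<longleftrightarrow> 0 < (dist13 u)\<^sup>2" "0 < dist23 u \<longleftrightarrow> 0 < (dist23 u)\<^sup>2"
    using dist_nonneg[of u] by (auto simp: less_le)
  then show ?thesis
    unfolding collision_free_def dist13_square dist23_square by (auto simp: dist12_def abs_less_iff)
qed

lemma potential_less_of_inner_less:
  assumes "collision_free u" and "norm (fst w) = norm (fst u)" "norm (snd w) = norm (snd u)"
    and "\<bar>fst w \<bullet> snd w\<bar> < \<bar>fst u \<bullet> snd u\<bar>"
  shows "potential w < potential u"
proof -
  have "\<bar>fst u \<bullet> snd u\<bar> < (norm (snd u))\<^sup>2 + (norm (fst u))\<^sup>2 / 4"
    using assms(1) by (simp add: collision_free_iff_inner)
  from inverse_sqrt_pair_less[OF this assms(4)] show ?thesis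
    unfolding potential_eq_inverse_sqrt_pair assms(2,3) by simp
qed

lemma potential_le_of_inner_le:
  assumes "collision_free u" and "norm (fst w) = norm (fst u)" "norm (snd w) = norm (snd u)"
    and "\<bar>fst w \<bullet> snd w\<bar> \<le> \<bar>fst u \<bullet> snd u\<bar>"
  shows "potential w \<le> potential u"
proof (cases "\<bar>fst w \<bullet> snd w\<bar> = \<bar>fst u \<bullet> snd u\<bar>")
  case True
  then show ?thesis
    using assms(2,3) by (auto simp: potential_eq_inverse_sqrt_pair abs_eq_iff)
next
  case False
  then show ?thesis using potential_less_of_inner_less[OF assms(1-3)] assms(4) by simp
qed

text \<open>This is $(\widetilde Z_1, \widetilde Z_2)$.\<close>
definition quadrant_fold :: "config \<Rightarrow> config" where
  "quadrant_fold u = ((\<bar>fst (fst u)\<bar>, \<bar>snd (fst u)\<bar>), (\<bar>fst (snd u)\<bar>, - \<bar>snd (snd u)\<bar>))"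

definition fold_sign :: "config \<Rightarrow> real" where
  "fold_sign i = (if i = (0, (0, 1)) then - 1 else 1)"

lemma inner_quadrant_fold: "i \<in> Basis \<Longrightarrow> quadrant_fold u \<bullet> i = fold_sign i * \<bar>u \<bullet> i\<bar>"
  by (auto simp: Basis_prod_def quadrant_fold_def fold_sign_def inner_prod_def zero_prod_def)

lemma norm_quadrant_fold:
  "norm (fst (quadrant_fold u)) = norm (fst u)" "norm (snd (quadrant_fold u)) = norm (snd u)"
  by (simp_all add: quadrant_fold_def norm_prod_def)

lemma inner_quadrant_fold_le:
  "\<bar>fst (quadrant_fold u) \<bullet> snd (quadrant_fold u)\<bar> \<le> \<bar>fst u \<bullet> snd u\<bar>"
  by (simp add: quadrant_fold_def inner_prod_def abs_mult[symmetric])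

lemma inner_quadrant_fold_less:
  assumes "0 < (fst (fst u) * fst (snd u)) * (snd (fst u) * snd (snd u))"
  shows "\<bar>fst (quadrant_fold u) \<bullet> snd (quadrant_fold u)\<bar> < \<bar>fst u \<bullet> snd u\<bar>"
proof -
  have "\<bar>\<bar>x\<bar> - \<bar>y\<bar>\<bar> < \<bar>x + y\<bar>" if "0 < x * y" for x y :: real
    using that by (auto simp: zero_less_mult_iff)
  from this[OF assms] show ?thesis
    by (simp add: quadrant_fold_def inner_prod_def abs_mult)
qed

lemma collision_free_quadrant_fold: "collision_free u \<Longrightarrow> collision_free (quadrant_fold u)"
  using inner_quadrant_fold_le[of u] unfolding collision_free_iff_inner norm_quadrant_fold by linarith

lemma potential_quadrant_fold_le: "collision_free u \<Longrightarrow> potential (quadrant_fold u) \<le> potential u"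
  by (rule potential_le_of_inner_le[OF _ norm_quadrant_fold inner_quadrant_fold_le])

lemma potential_quadrant_fold_less:
  assumes "collision_free u" "0 < (fst (fst u) * fst (snd u)) * (snd (fst u) * snd (snd u))"
  shows "potential (quadrant_fold u) < potential u"
  by (rule potential_less_of_inner_less[OF assms(1) norm_quadrant_fold])
    (rule inner_quadrant_fold_less[OF assms(2)])

lemma start_config_quadrant_fold: "start_config u \<Longrightarrow> start_config (quadrant_fold u)"
  by (simp add: start_config_def quadrant_fold_def zero_prod_def prod_eq_iff)

lemma end_config_quadrant_fold: "end_config u \<Longrightarrow> end_config (quadrant_fold u)"
  by (auto simp: end_config_def quadrant_fold_def abs_if)

lemma continuous_on_quadrant_fold: "continuous_on S quadrant_fold"
  unfolding quadrant_fold_def by (intro continuous_intros)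

lemma tendsto_potential:
  assumes "(U \<longlongrightarrow> u) F" "collision_free u"
  shows "((\<lambda>x. potential (U x)) \<longlongrightarrow> potential u) F"
  using assms(2) unfolding potential_def dist12_def dist13_def dist23_def collision_free_def
  by (intro tendsto_intros assms(1)) auto

lemma eventually_collision_free:
  assumes "(U \<longlongrightarrow> u) F" "collision_free u"
  shows "\<forall>\<^sub>F x in F. collision_free (U x)"
proof -
  have "((\<lambda>x. dist12 (U x)) \<longlongrightarrow> dist12 u) F" "((\<lambda>x. dist13 (U x)) \<longlongrightarrow> dist13 u) F"
    "((\<lambda>x. dist23 (U x)) \<longlongrightarrow> dist23 u) F"
    unfolding dist12_def dist13_def dist23_def by (intro tendsto_intros assms(1))+
  then show ?thesis
    using assms(2) unfolding collision_free_def by (intro eventually_conj order_tendstoD(1)) auto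
qed

definition replace_component :: "'a::euclidean_space \<Rightarrow> real \<Rightarrow> 'a \<Rightarrow> 'a" where
  "replace_component i c u = u + (c - u \<bullet> i) *\<^sub>R i"

lemma inner_replace_component:
  "i \<in> Basis \<Longrightarrow> j \<in> Basis \<Longrightarrow> replace_component i c u \<bullet> j = (if j = i then c else u \<bullet> j)"
  by (simp add: replace_component_def inner_add_left inner_Basis)

lemma kinetic_components:
  "kinetic e = ((fst (fst e))\<^sup>2 + (snd (fst e))\<^sup>2) / 4 + ((fst (snd e))\<^sup>2 + (snd (snd e))\<^sup>2) / 3"
  by (simp add: kinetic_def norm_prod_def)

lemma kinetic_mono:
  assumes "\<And>i. i \<in> Basis \<Longrightarrow> \<bar>w \<bullet> i\<bar> \<le> \<bar>e \<bullet> i\<bar>"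
  shows "kinetic w \<le> kinetic e"
proof -
  have "\<bar>fst (fst w)\<bar> \<le> \<bar>fst (fst e)\<bar>" "\<bar>snd (fst w)\<bar> \<le> \<bar>snd (fst e)\<bar>"
    "\<bar>fst (snd w)\<bar> \<le> \<bar>fst (snd e)\<bar>" "\<bar>snd (snd w)\<bar> \<le> \<bar>snd (snd e)\<bar>"
    using assms[of "((1, 0), 0)"] assms[of "((0, 1), 0)"] assms[of "(0, (1, 0))"] assms[of "(0, (0, 1))"]
    by (auto simp: Basis_prod_def inner_prod_def)
  then show ?thesis
    unfolding kinetic_components abs_le_square_iff by (intro add_mono divide_right_mono) auto
qed

lemma kinetic_replace_component_zero:
  "i \<in> Basis \<Longrightarrow> kinetic (replace_component i 0 e) + (e \<bullet> i)\<^sup>2 / 4 \<le> kinetic e"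
  by (auto simp: Basis_prod_def replace_component_def kinetic_components inner_prod_def)

lemma inner_square_le_kinetic: "i \<in> Basis \<Longrightarrow> (e \<bullet> i)\<^sup>2 \<le> 4 * kinetic e"
  using kinetic_replace_component_zero[of i e] kinetic_nonneg[of "replace_component i 0 e"] by simp

section \<open>Newton's equations in Jacobi coordinates\<close>

definition attraction1 :: "config \<Rightarrow> real" where
  "attraction1 u = 2 / dist12 u ^ 3 + (1 / dist13 u ^ 3 + 1 / dist23 u ^ 3) / 2"

definition attraction2 :: "config \<Rightarrow> real" where
  "attraction2 u = 3/2 * (1 / dist13 u ^ 3 + 1 / dist23 u ^ 3)"

text \<open>This is $(r_{13}^{-3} - r_{23}^{-3}) / (Z_1 \cdot Z_2)$ in a form without singularity at
  $Z_1 \cdot Z_2 = 0$, using $r_{23}^2 - r_{13}^2 = 2 Z_1 \cdot Z_2$.\<close>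
definition coupling :: "config \<Rightarrow> real" where
  "coupling u = 2 * ((dist13 u)\<^sup>2 + dist13 u * dist23 u + (dist23 u)\<^sup>2)
     / ((dist13 u + dist23 u) * (dist13 u * dist23 u) ^ 3)"

definition jacobi_acceleration :: "config \<Rightarrow> config" where
  "jacobi_acceleration u =
    ((coupling u * (fst u \<bullet> snd u)) *\<^sub>R snd u - attraction1 u *\<^sub>R fst u,
     (3/4 * coupling u * (fst u \<bullet> snd u)) *\<^sub>R fst u - attraction2 u *\<^sub>R snd u)"

lemma inverse_cube_diff:
  fixes r s :: real
  assumes "0 < r" "0 < s"
  shows "1 / r ^ 3 - 1 / s ^ 3 = 2 * (r\<^sup>2 + r * s + s\<^sup>2) / ((r + s) * (r * s) ^ 3) * ((s\<^sup>2 - r\<^sup>2) / 2)"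
proof -
  have "1 / r ^ 3 - 1 / s ^ 3 = (s ^ 3 - r ^ 3) / (r * s) ^ 3"
    using assms by (simp add: field_simps)
  also have "s ^ 3 - r ^ 3 = (r\<^sup>2 + r * s + s\<^sup>2) * (s\<^sup>2 - r\<^sup>2) / (r + s)"
    using assms by (simp add: field_simps power2_eq_square power3_eq_cube)
  also have "\<dots> / (r * s) ^ 3 = 2 * (r\<^sup>2 + r * s + s\<^sup>2) / ((r + s) * (r * s) ^ 3) * ((s\<^sup>2 - r\<^sup>2) / 2)"
  proof -
    have "X * Y / Z / W = 2 * X / (Z * W) * (Y / 2)" for X Y Z W :: real by simp
    then show ?thesis .
  qed
  finally show ?thesis .
qed

lemma coupling_inner:
  assumes "collision_free u"
  shows "coupling u * (fst u \<bullet> snd u) = 1 / dist13 u ^ 3 - 1 / dist23 u ^ 3"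
proof -
  have "fst u \<bullet> snd u = ((dist23 u)\<^sup>2 - (dist13 u)\<^sup>2) / 2"
    by (simp add: dist13_square dist23_square)
  moreover have "0 < dist13 u" "0 < dist23 u" using assms by (simp_all add: collision_free_def)
  ultimately show ?thesis unfolding coupling_def by (simp only: inverse_cube_diff)
qed

lemma coupling_pos: "collision_free u \<Longrightarrow> 0 < coupling u"
  unfolding collision_free_def coupling_def
  by (intro divide_pos_pos mult_pos_pos add_pos_pos zero_less_power) auto

lemma jacobi_force:
  assumes "collision_free u"
  shows "jacobi (force (body1 u) (body2 u) (body3 u)) (force (body2 u) (body1 u) (body3 u))
    (force (body3 u) (body1 u) (body2 u)) = jacobi_acceleration u"
proof -
  define R S T where "R = 1 / dist12 u ^ 3" and "S = 1 / dist13 u ^ 3" and "T = 1 / dist23 u ^ 3"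
  have force: "force (body1 u) (body2 u) (body3 u) = R *\<^sub>R (body2 u - body1 u) + S *\<^sub>R (body3 u - body1 u)"
    "force (body2 u) (body1 u) (body3 u) = R *\<^sub>R (body1 u - body2 u) + T *\<^sub>R (body3 u - body2 u)"
    "force (body3 u) (body1 u) (body2 u) = S *\<^sub>R (body1 u - body3 u) + T *\<^sub>R (body2 u - body3 u)"
    unfolding force_def R_def S_def T_def
    by (simp_all add: dist_bodies[symmetric] dist_norm norm_minus_commute)
  have "jacobi_acceleration u = ((S - T) *\<^sub>R snd u - (2 * R + (S + T) / 2) *\<^sub>R fst u,
      (3/4 * (S - T)) *\<^sub>R fst u - (3/2 * (S + T)) *\<^sub>R snd u)"
    using coupling_inner[OF assms]
    by (simp add: jacobi_acceleration_def attraction1_def attraction2_def R_def S_def T_def mult.assoc)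
  then show ?thesis
    unfolding force by (simp add: jacobi_def body1_def body2_def body3_def prod_eq_iff field_simps)
qed

lemma continuous_on_attraction_coupling:
  assumes u: "continuous_on S u" and "\<And>t. t \<in> S \<Longrightarrow> collision_free (u t)"
  shows "continuous_on S (\<lambda>t. attraction1 (u t))" "continuous_on S (\<lambda>t. attraction2 (u t))"
    "continuous_on S (\<lambda>t. coupling (u t))"
proof -
  have dist: "continuous_on S (\<lambda>t. dist12 (u t))" "continuous_on S (\<lambda>t. dist13 (u t))"
    "continuous_on S (\<lambda>t. dist23 (u t))"
    unfolding dist12_def dist13_def dist23_def by (intro continuous_intros u)+
  have "dist12 (u t) \<noteq> 0 \<and> dist13 (u t) \<noteq> 0 \<and> dist23 (u t) \<noteq> 0 \<and> dist13 (u t) + dist23 (u t) \<noteq> 0"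
    if "t \<in> S" for t
    using assms(2)[OF that] unfolding collision_free_def by auto
  then show "continuous_on S (\<lambda>t. attraction1 (u t))" "continuous_on S (\<lambda>t. attraction2 (u t))"
    "continuous_on S (\<lambda>t. coupling (u t))"
    unfolding attraction1_def attraction2_def coupling_def
    by (intro continuous_intros dist; simp)+
qed

lemma has_vector_derivative_jacobi:
  assumes "(p1 has_vector_derivative w1) (at t)" "(p2 has_vector_derivative w2) (at t)"
    "(p3 has_vector_derivative w3) (at t)"
  shows "((\<lambda>t. jacobi (p1 t) (p2 t) (p3 t)) has_vector_derivative jacobi w1 w2 w3) (at t)"
  unfolding jacobi_def
  by (intro has_vector_derivative_Pair has_vector_derivative_diff has_vector_derivative_add
      bounded_linear.has_vector_derivative[OF bounded_linear_scaleR_right] assms)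

lemma newton_on_imp_jacobi_acceleration:
  assumes newton: "newton_on S q1 q2 q3" and "open S"
    and center: "\<And>t. t \<in> S \<Longrightarrow> q1 t + q2 t + q3 t = 0"
    and free: "\<And>t. t \<in> S \<Longrightarrow> collision_free (jacobi (q1 t) (q2 t) (q3 t))"
  obtains v where
    "\<And>t. t \<in> S \<Longrightarrow> ((\<lambda>t. jacobi (q1 t) (q2 t) (q3 t)) has_vector_derivative v t) (at t)"
    "\<And>t. t \<in> S \<Longrightarrow> (v has_vector_derivative jacobi_acceleration (jacobi (q1 t) (q2 t) (q3 t))) (at t)"
proof -
  obtain v1 v2 v3 where v: "\<And>t. t \<in> S \<Longrightarrow>
      (q1 has_vector_derivative v1 t) (at t) \<and> (q2 has_vector_derivative v2 t) (at t) \<and>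
      (q3 has_vector_derivative v3 t) (at t) \<and>
      (v1 has_vector_derivative force (q1 t) (q2 t) (q3 t)) (at t) \<and>
      (v2 has_vector_derivative force (q2 t) (q1 t) (q3 t)) (at t) \<and>
      (v3 has_vector_derivative force (q3 t) (q1 t) (q2 t)) (at t)"
    using newton unfolding newton_on_def by blast
  show thesis
  proof (rule that)
    fix t assume t: "t \<in> S"
    show "((\<lambda>t. jacobi (q1 t) (q2 t) (q3 t)) has_vector_derivative jacobi (v1 t) (v2 t) (v3 t)) (at t)"
      using v[OF t] by (intro has_vector_derivative_jacobi) auto
    have "((\<lambda>t. jacobi (v1 t) (v2 t) (v3 t)) has_vector_derivative
        jacobi (force (q1 t) (q2 t) (q3 t)) (force (q2 t) (q1 t) (q3 t))
          (force (q3 t) (q1 t) (q2 t))) (at t)"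
      using v[OF t] by (intro has_vector_derivative_jacobi) auto
    then show "((\<lambda>t. jacobi (v1 t) (v2 t) (v3 t)) has_vector_derivative
        jacobi_acceleration (jacobi (q1 t) (q2 t) (q3 t))) (at t)"
      using jacobi_force[OF free[OF t]] by (simp add: bodies_jacobi[OF center[OF t]])
  qed
qed

section \<open>Least action and reflection\<close>

locale least_action_path =
  fixes z v :: "real \<Rightarrow> config"
  assumes continuous_path: "continuous_on {0..1} z"
    and path_deriv: "\<And>t. t \<in> {0<..<1} \<Longrightarrow> (z has_vector_derivative v t) (at t)"
    and continuous_velocity: "continuous_on {0<..<1} v"
    and collision_free_path: "\<And>t. t \<in> {0<..1} \<Longrightarrow> collision_free (z t)"
    and start: "start_config (z 0)" and finish: "end_config (z 1)"
    and finite_action: "lagrangian_action z v < \<infinity>"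
    and least_action: "\<And>u d. competitor u d \<Longrightarrow> lagrangian_action z v \<le> lagrangian_action u d"
begin

lemma weak_velocity_path: "weak_velocity 0 1 z v"
  by (rule weak_velocity_differentiable) (fact continuous_path continuous_velocity path_deriv)+

lemma tendsto_path: "t \<in> {0<..<1} \<Longrightarrow> (z \<longlongrightarrow> z t) (nhds t)"
  using has_vector_derivative_continuous[OF path_deriv, of t]
  unfolding continuous_within tendsto_at_iff_tendsto_nhds .

lemma tendsto_velocity: "t \<in> {0<..<1} \<Longrightarrow> (v \<longlongrightarrow> v t) (nhds t)"
  using continuous_on_interior[OF continuous_velocity, of t]
  unfolding continuous_within tendsto_at_iff_tendsto_nhds by simp

lemma component_deriv:
  assumes "t \<in> {0<..<1}"
  shows "((\<lambda>t. z t \<bullet> i) has_real_derivative v t \<bullet> i) (at t)"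
  unfolding has_real_derivative_iff_has_vector_derivative
  using path_deriv[OF assms] by (rule bounded_linear.has_vector_derivative[OF bounded_linear_inner_left])

lemma path_in_closed_set:
  assumes "closed T" and inside: "\<And>t. t \<in> {0<..<1} \<Longrightarrow> z t \<in> T" and t: "t \<in> {0..1}"
  shows "z t \<in> T"
proof -
  have "z ` closure {0<..<1} \<subseteq> T"
    by (rule image_closure_subset) (use continuous_path \<open>closed T\<close> inside in auto)
  with t show ?thesis by auto
qed

lemma path_functional_constant_sign:
  assumes f: "continuous_on UNIV f" and nonzero: "\<And>t. t \<in> {0<..<1} \<Longrightarrow> f (z t) \<noteq> (0 :: real)"
  shows "(\<forall>t\<in>{0<..<1}. 0 < f (z t)) \<or> (\<forall>t\<in>{0<..<1}. f (z t) < 0)"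
proof (rule connected_nonzero_constant_sign)
  have "continuous_on {0<..<1} z" by (rule continuous_on_subset[OF continuous_path]) auto
  then show "continuous_on {0<..<1} (\<lambda>t. f (z t))" by (rule continuous_on_compose2[OF f]) auto
qed (use nonzero in auto)

lemma path_functional_positive:
  assumes f: "continuous_on UNIV f" and nonzero: "\<And>t. t \<in> {0<..<1} \<Longrightarrow> f (z t) \<noteq> (0 :: real)"
    and s: "s \<in> {0..1}" "0 < f (z s)" and t: "t \<in> {0<..<1}"
  shows "0 < f (z t)"
proof (rule ccontr)
  assume "\<not> 0 < f (z t)"
  then have "\<forall>t\<in>{0<..<1}. f (z t) < 0"
    using path_functional_constant_sign[OF f nonzero] t by blast
  moreover have "closed {u. f u \<le> 0}" by (intro closed_Collect_le f continuous_intros)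
  ultimately have "f (z s) \<le> 0"
    using path_in_closed_set[of "{u. f u \<le> 0}" s] s(1) by (simp add: less_imp_le)
  with s(2) show False by simp
qed

lemma no_better_competitor:
  assumes ud: "competitor u d" and order: "0 \<le> p" "p < q" "q \<le> 1"
    and lagrangian_le: "\<And>t. t \<in> {0<..<1} \<Longrightarrow> lagrangian (u t) (d t) \<le> lagrangian (z t) (v t)"
    and lagrangian_less: "\<And>t. t \<in> {p<..<q} \<Longrightarrow> lagrangian (u t) (d t) < lagrangian (z t) (v t)"
  shows False
proof -
  let ?L = "\<lambda>u d t. ennreal (lagrangian (u t) (d t)) * indicator {0<..<1} t"
  have integrand_le: "?L u d t \<le> ?L z v t" for t
    using lagrangian_le[of t] by (simp add: indicator_def ennreal_leI)
  have "lagrangian_action u d < lagrangian_action z v"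
    unfolding lagrangian_action_def
  proof (rule nn_integral_less)
    show "?L u d \<in> borel_measurable lborel" "?L z v \<in> borel_measurable lborel"
      using ud lagrangian_measurable weak_velocity_path by (simp_all add: competitor_def)
    have "(\<integral>\<^sup>+t. ?L u d t \<partial>lborel) \<le> lagrangian_action z v"
      unfolding lagrangian_action_def by (intro nn_integral_mono integrand_le)
    with finite_action show "(\<integral>\<^sup>+t. ?L u d t \<partial>lborel) \<noteq> \<infinity>" by auto
    show "\<not> (AE t in lborel. ?L z v t \<le> ?L u d t)"
    proof
      assume "AE t in lborel. ?L z v t \<le> ?L u d t"
      moreover have "\<not> ?L z v t \<le> ?L u d t" if "t \<in> {p<..<q}" for t
        using lagrangian_less[OF that] that order by (simp add: ennreal_less_iff lagrangian_nonneg not_le)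
      ultimately have "AE t in lborel. t \<notin> {p<..<q}" by (auto elim!: eventually_mono)
      then have "{p<..<q} \<in> null_sets lborel" by (subst AE_iff_null_sets) auto
      then show False using order by (simp add: null_sets_def)
    qed
  qed (use integrand_le in simp)
  with least_action[OF ud] show False by simp
qed

definition fold_velocity :: "real \<Rightarrow> config" where
  "fold_velocity t = (\<Sum>i\<in>Basis. (fold_sign i * (sgn (z t \<bullet> i) * (v t \<bullet> i))) *\<^sub>R i)"

lemma inner_fold_velocity:
  "i \<in> Basis \<Longrightarrow> fold_velocity t \<bullet> i = fold_sign i * (sgn (z t \<bullet> i) * (v t \<bullet> i))"
  by (simp add: fold_velocity_def)

lemma abs_inner_fold_velocity_le:
  "i \<in> Basis \<Longrightarrow> \<bar>fold_velocity t \<bullet> i\<bar> \<le> \<bar>v t \<bullet> i\<bar>"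
  by (simp add: inner_fold_velocity fold_sign_def sgn_if)

lemma velocity_component_integrable:
  assumes i: "i \<in> Basis"
  shows "(\<lambda>t. \<bar>v t \<bullet> i\<bar>) integrable_on {0..1}"
proof -
  have "(\<integral>\<^sup>+t\<in>{0<..<1}. ennreal ((norm (v t \<bullet> i))\<^sup>2) \<partial>lborel) < \<infinity>"
    using finite_action_imp_finite_velocity_integral[OF weak_velocity_path finite_action,
        of "\<lambda>e. (e \<bullet> i)\<^sup>2" 4] inner_square_le_kinetic[OF i] by simp
  moreover have "set_borel_measurable lborel {0<..<1} (\<lambda>t. v t \<bullet> i)"
    using set_measurable_continuous_on[of "{0<..<1}" "\<lambda>t. v t \<bullet> i"] continuous_velocity
    by (simp add: set_borel_measurable_def continuous_on_inner)
  ultimately have "set_integrable lborel {0<..<1} (\<lambda>t. v t \<bullet> i)"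
    by (intro set_integrable_of_square) auto
  then have "set_integrable lborel {0<..<1} (\<lambda>t. \<bar>v t \<bullet> i\<bar>)" by (rule set_integrable_abs)
  from set_borel_integral_eq_integral(1)[OF this] show ?thesis
    by (simp add: integrable_on_open_interval_real)
qed

lemma weak_velocity_abs_component:
  assumes "i \<in> Basis"
  shows "weak_velocity 0 1 (\<lambda>t. \<bar>z t \<bullet> i\<bar>) (\<lambda>t. sgn (z t \<bullet> i) * (v t \<bullet> i))"
proof (rule weak_velocity_abs)
  show "continuous_on {0..1} (\<lambda>t. z t \<bullet> i)" "continuous_on {0<..<1} (\<lambda>t. v t \<bullet> i)"
    by (intro continuous_intros continuous_path continuous_velocity)+
qed (use component_deriv velocity_component_integrable[OF assms] in auto)

lemma weak_velocity_fold_sign: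
  "weak_velocity 0 1 f g \<Longrightarrow> weak_velocity 0 1 (\<lambda>t. fold_sign i * f t) (\<lambda>t. fold_sign i * g t)"
  by (rule weak_velocity_linear[OF _ bounded_linear_mult_right])

lemma weak_velocity_quadrant_fold_component:
  assumes "i \<in> Basis"
  shows "weak_velocity 0 1 (\<lambda>t. quadrant_fold (z t) \<bullet> i) (\<lambda>t. fold_velocity t \<bullet> i)"
  using weak_velocity_fold_sign[OF weak_velocity_abs_component[OF assms]]
  by (simp add: inner_quadrant_fold inner_fold_velocity assms)

lemma competitor_quadrant_fold: "competitor (\<lambda>t. quadrant_fold (z t)) fold_velocity"
  unfolding competitor_def
proof (intro conjI ballI)
  show "weak_velocity 0 1 (\<lambda>t. quadrant_fold (z t)) fold_velocity"
    by (rule weak_velocity_componentwise[OF weak_velocity_quadrant_fold_component])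
qed (use start finish collision_free_path start_config_quadrant_fold end_config_quadrant_fold
    collision_free_quadrant_fold in auto)

lemma lagrangian_quadrant_fold_le:
  assumes "t \<in> {0<..<1}"
  shows "lagrangian (quadrant_fold (z t)) (fold_velocity t) \<le> lagrangian (z t) (v t)"
  unfolding lagrangian_def
  using assms collision_free_path
  by (intro add_mono kinetic_mono abs_inner_fold_velocity_le potential_quadrant_fold_le) auto

lemma sign_condition:
  assumes t: "t \<in> {0<..<1}"
  shows "(fst (fst (z t)) * fst (snd (z t))) * (snd (fst (z t)) * snd (snd (z t))) \<le> 0"
    (is "?sign t \<le> 0")
proof (rule ccontr)
  assume "\<not> ?sign t \<le> 0"
  moreover have "(?sign \<longlongrightarrow> ?sign t) (nhds t)" by (intro tendsto_intros tendsto_path t)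
  ultimately have "\<forall>\<^sub>F s in nhds t. 0 < ?sign s" by (simp add: order_tendstoD(1) not_le)
  moreover have "\<forall>\<^sub>F s in nhds t. s \<in> {0<..<1}" using t by (intro eventually_nhds_in_open) auto
  ultimately have "\<forall>\<^sub>F s in at_right t. 0 < ?sign s \<and> s \<in> {0<..<1}"
    by (auto simp: eventually_at_filter elim: eventually_elim2)
  then obtain q where q: "t < q" "\<And>s. t < s \<Longrightarrow> s < q \<Longrightarrow> 0 < ?sign s \<and> s \<in> {0<..<1}"
    unfolding eventually_at_right_field by blast
  show False
  proof (rule no_better_competitor[OF competitor_quadrant_fold])
    show "lagrangian (quadrant_fold (z s)) (fold_velocity s) < lagrangian (z s) (v s)"
      if "s \<in> {t<..<min q 1}" for s
      unfolding lagrangian_def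
      using that q(2)[of s] collision_free_path[of s]
      by (intro add_le_less_mono kinetic_mono abs_inner_fold_velocity_le potential_quadrant_fold_less) auto
  qed (use t q(1) lagrangian_quadrant_fold_le in auto)
qed

text \<open>If a component $z_i$ changes sign with nonzero velocity, its reflection has a corner. Replacing
  $|z_i|$ by the constant $c$ between two nearby times with $|z_i| = c$ removes the kinetic energy of this
  component, which is bounded below, while the potential changes by an amount that tends to 0 with $c$.\<close>
definition flat_path :: "config \<Rightarrow> real \<Rightarrow> real \<Rightarrow> real \<Rightarrow> real \<Rightarrow> config" where
  "flat_path i c p q t =
    (if t \<in> {p..q} then replace_component i (fold_sign i * c) (quadrant_fold (z t))
     else quadrant_fold (z t))"

definition flat_velocity :: "config \<Rightarrow> real \<Rightarrow> real \<Rightarrow> real \<Rightarrow> config" where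
  "flat_velocity i p q t =
    (if t \<in> {p..q} then replace_component i 0 (fold_velocity t) else fold_velocity t)"

lemma weak_velocity_flat_path:
  assumes i: "i \<in> Basis" and pq: "0 \<le> p" "p \<le> q" "q \<le> 1" "\<bar>z p \<bullet> i\<bar> = c" "\<bar>z q \<bullet> i\<bar> = c"
  shows "weak_velocity 0 1 (flat_path i c p q) (flat_velocity i p q)"
proof (rule weak_velocity_componentwise)
  fix j :: config assume j: "j \<in> Basis"
  show "weak_velocity 0 1 (\<lambda>t. flat_path i c p q t \<bullet> j) (\<lambda>t. flat_velocity i p q t \<bullet> j)"
  proof (cases "j = i")
    case True
    have "(\<lambda>t. flat_path i c p q t \<bullet> j) = (\<lambda>t. fold_sign i * (if t \<in> {p..q} then c else \<bar>z t \<bullet> i\<bar>))"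
      "(\<lambda>t. flat_velocity i p q t \<bullet> j)
        = (\<lambda>t. fold_sign i * (if t \<in> {p..q} then 0 else sgn (z t \<bullet> i) * (v t \<bullet> i)))"
      using True i by (auto simp: flat_path_def flat_velocity_def fun_eq_iff inner_replace_component
          inner_quadrant_fold inner_fold_velocity)
    then show ?thesis
      using weak_velocity_fold_sign[OF weak_velocity_flatten[OF weak_velocity_abs_component[OF i] pq]]
      by simp
  next
    case False
    then have "(\<lambda>t. flat_path i c p q t \<bullet> j) = (\<lambda>t. quadrant_fold (z t) \<bullet> j)"
      "(\<lambda>t. flat_velocity i p q t \<bullet> j) = (\<lambda>t. fold_velocity t \<bullet> j)"
      using i j by (auto simp: flat_path_def flat_velocity_def fun_eq_iff inner_replace_component)
    then show ?thesis using weak_velocity_quadrant_fold_component[OF j] by simp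
  qed
qed

lemma competitor_flat_path:
  assumes "i \<in> Basis" and "0 < p" "p \<le> q" "q < 1" "\<bar>z p \<bullet> i\<bar> = c" "\<bar>z q \<bullet> i\<bar> = c"
    and "\<And>t. t \<in> {p..q} \<Longrightarrow> collision_free (flat_path i c p q t)"
  shows "competitor (flat_path i c p q) (flat_velocity i p q)"
proof -
  have "collision_free (flat_path i c p q t)" if "t \<in> {0<..<1}" for t
    using assms(7)[of t] that collision_free_path[of t] collision_free_quadrant_fold
    by (cases "t \<in> {p..q}") (auto simp: flat_path_def)
  moreover have "flat_path i c p q 0 = quadrant_fold (z 0)" "flat_path i c p q 1 = quadrant_fold (z 1)"
    using assms by (simp_all add: flat_path_def)
  ultimately show ?thesis
    using assms start finish weak_velocity_flat_path start_config_quadrant_fold end_config_quadrant_fold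
    by (simp add: competitor_def)
qed

lemma kinetic_flat_velocity_le:
  assumes i: "i \<in> Basis" and t: "t \<in> {p..q}"
  shows "kinetic (flat_velocity i p q t) + (v t \<bullet> i)\<^sup>2 / 4 \<le> kinetic (v t)"
proof -
  have "kinetic (flat_velocity i p q t) \<le> kinetic (replace_component i 0 (v t))"
    using t i by (intro kinetic_mono)
      (auto simp: flat_velocity_def inner_replace_component abs_inner_fold_velocity_le)
  then show ?thesis using kinetic_replace_component_zero[OF i, of "v t"] by simp
qed

lemma eventually_flattening_better:
  assumes i: "i \<in> Basis" and t0: "t0 \<in> {0<..<1}" and zero: "z t0 \<bullet> i = 0" and nonzero: "v t0 \<bullet> i \<noteq> 0"
  shows "\<forall>\<^sub>F (t, c) in nhds t0 \<times>\<^sub>F nhds 0.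
    collision_free (replace_component i (fold_sign i * c) (quadrant_fold (z t))) \<and>
    potential (replace_component i (fold_sign i * c) (quadrant_fold (z t)))
      < potential (z t) + (v t \<bullet> i)\<^sup>2 / 4"
proof -
  let ?F = "nhds t0 \<times>\<^sub>F nhds (0 :: real)"
  let ?U = "\<lambda>(t, c). replace_component i (fold_sign i * c) (quadrant_fold (z t))"
  let ?L = "quadrant_fold (z t0)"
  have path: "((\<lambda>x. z (fst x)) \<longlongrightarrow> z t0) ?F" and velocity: "((\<lambda>x. v (fst x)) \<longlongrightarrow> v t0) ?F"
    using filterlim_compose[OF tendsto_path[OF t0] filterlim_fst]
      filterlim_compose[OF tendsto_velocity[OF t0] filterlim_fst] by auto
  have free: "collision_free (z t0)" using t0 collision_free_path by simp
  have fold: "((\<lambda>x. quadrant_fold (z (fst x))) \<longlongrightarrow> ?L) ?F"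
    using continuous_on_tendsto_compose[OF continuous_on_quadrant_fold[of UNIV] path] by simp
  have "?L \<bullet> i = 0" using i zero by (simp add: inner_quadrant_fold)
  have "(?U \<longlongrightarrow> ?L + (fold_sign i * 0 - ?L \<bullet> i) *\<^sub>R i) ?F"
    unfolding replace_component_def case_prod_unfold
    by (intro tendsto_intros fold filterlim_snd)
  then have limit: "(?U \<longlongrightarrow> ?L) ?F" using \<open>?L \<bullet> i = 0\<close> by simp
  note free_fold = collision_free_quadrant_fold[OF free]
  have "((\<lambda>x. potential (z (fst x)) + (v (fst x) \<bullet> i)\<^sup>2 / 4 - potential (?U x))
      \<longlongrightarrow> potential (z t0) + (v t0 \<bullet> i)\<^sup>2 / 4 - potential ?L) ?F"
    by (intro tendsto_intros tendsto_potential path velocity limit free free_fold) simp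
  moreover have "0 < (v t0 \<bullet> i)\<^sup>2" using nonzero by simp
  then have "0 < potential (z t0) + (v t0 \<bullet> i)\<^sup>2 / 4 - potential ?L"
    using potential_quadrant_fold_le[OF free] by linarith
  ultimately have "\<forall>\<^sub>F x in ?F. 0 < potential (z (fst x)) + (v (fst x) \<bullet> i)\<^sup>2 / 4 - potential (?U x)"
    by (rule order_tendstoD(1))
  moreover have "\<forall>\<^sub>F x in ?F. collision_free (?U x)"
    by (rule eventually_collision_free[OF limit free_fold])
  ultimately show ?thesis
    by eventually_elim auto
qed

lemma flat_path_better:
  assumes i: "i \<in> Basis" and t0: "t0 \<in> {0<..<1}" and zero: "z t0 \<bullet> i = 0" and nonzero: "v t0 \<bullet> i \<noteq> 0"
  obtains p q c where "0 < p" "p < q" "q < 1" "\<bar>z p \<bullet> i\<bar> = c" "\<bar>z q \<bullet> i\<bar> = c"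
    "\<And>t. t \<in> {p..q} \<Longrightarrow> collision_free (flat_path i c p q t) \<and>
      lagrangian (flat_path i c p q t) (flat_velocity i p q t) < lagrangian (z t) (v t)"
proof -
  let ?U = "\<lambda>t c. replace_component i (fold_sign i * c) (quadrant_fold (z t))"
  obtain P Q where P: "\<forall>\<^sub>F t in nhds t0. P t" and Q: "\<forall>\<^sub>F c in nhds 0. Q c"
    and better: "\<And>t c. P t \<Longrightarrow> Q c \<Longrightarrow> collision_free (?U t c) \<and>
      potential (?U t c) < potential (z t) + (v t \<bullet> i)\<^sup>2 / 4"
    using eventually_flattening_better[OF assms] unfolding eventually_prod_filter by auto
  have "\<forall>\<^sub>F t in nhds t0. t \<in> {0<..<1}" using t0 by (intro eventually_nhds_in_open) auto
  with P have "\<forall>\<^sub>F t in nhds t0. P t \<and> t \<in> {0<..<1}" by (rule eventually_conj)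
  then obtain \<delta> where "0 < \<delta>" and \<delta>: "\<And>t. dist t t0 \<le> \<delta> \<Longrightarrow> P t \<and> t \<in> {0<..<1}"
    unfolding eventually_nhds_metric_le by blast
  obtain \<epsilon> where "0 < \<epsilon>" and \<epsilon>: "\<And>c. dist c 0 < \<epsilon> \<Longrightarrow> Q c"
    using Q unfolding eventually_nhds_metric by blast
  have near: "P t \<and> t \<in> {0<..<1}" if "t \<in> {t0 - \<delta>..t0 + \<delta>}" for t
    using \<delta>[of t] that by (auto simp: dist_real_def abs_le_iff)
  have "continuous_on {t0 - \<delta>..t0 + \<delta>} (\<lambda>t. z t \<bullet> i)"
    by (intro continuous_intros continuous_on_subset[OF continuous_path]) (use near in force)
  then obtain p q c where pq: "t0 - \<delta> < p" "p < t0" "t0 < q" "q < t0 + \<delta>"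
    and level: "0 < c" "c < \<epsilon>" "\<bar>z p \<bullet> i\<bar> = c" "\<bar>z q \<bullet> i\<bar> = c"
    by (rule transversal_zero_levels[OF _ _ _ component_deriv[OF t0] zero nonzero \<open>0 < \<epsilon>\<close>])
      (use \<open>0 < \<delta>\<close> in auto)
  have "collision_free (flat_path i c p q t) \<and>
      lagrangian (flat_path i c p q t) (flat_velocity i p q t) < lagrangian (z t) (v t)" if "t \<in> {p..q}" for t
    using better[of t c] near[of t] \<epsilon>[of c] kinetic_flat_velocity_le[OF i that] that pq level
    by (auto simp: lagrangian_def flat_path_def)
  then show thesis using that[of p q c] near[of p] near[of q] pq level by auto
qed

lemma zero_imp_velocity_zero:
  assumes i: "i \<in> Basis" and t0: "t0 \<in> {0<..<1}" and zero: "z t0 \<bullet> i = 0"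
  shows "v t0 \<bullet> i = 0"
proof (rule ccontr)
  assume "v t0 \<bullet> i \<noteq> 0"
  then obtain p q c where pq: "0 < p" "p < q" "q < 1" and level: "\<bar>z p \<bullet> i\<bar> = c" "\<bar>z q \<bullet> i\<bar> = c"
    and flat: "\<And>t. t \<in> {p..q} \<Longrightarrow> collision_free (flat_path i c p q t) \<and>
      lagrangian (flat_path i c p q t) (flat_velocity i p q t) < lagrangian (z t) (v t)"
    using flat_path_better[OF i t0 zero] by metis
  have outside: "lagrangian (flat_path i c p q t) (flat_velocity i p q t) \<le> lagrangian (z t) (v t)"
    if "t \<in> {0<..<1}" "t \<notin> {p..q}" for t
    unfolding flat_path_def flat_velocity_def if_not_P[OF that(2)]
    using lagrangian_quadrant_fold_le[OF that(1)] .
  show False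
  proof (rule no_better_competitor)
    show "competitor (flat_path i c p q) (flat_velocity i p q)"
      using i pq level flat by (intro competitor_flat_path) auto
    show "0 \<le> p" "p < q" "q \<le> 1" using pq by auto
    show "lagrangian (flat_path i c p q t) (flat_velocity i p q t) \<le> lagrangian (z t) (v t)"
      if "t \<in> {0<..<1}" for t
      using flat[of t] outside[OF that] less_imp_le by blast
    show "lagrangian (flat_path i c p q t) (flat_velocity i p q t) < lagrangian (z t) (v t)"
      if "t \<in> {p<..<q}" for t
      using flat[of t] that by simp
  qed
qed

lemma linear_components_vanish:
  assumes k: "k \<in> Basis" and l: "l \<in> Basis"
    and acceleration:
      "\<And>t. t \<in> {0<..<1} \<Longrightarrow> ((\<lambda>t. v t \<bullet> k) has_real_derivative a t * (z t \<bullet> k) + b t * (z t \<bullet> l)) (at t)"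
      "\<And>t. t \<in> {0<..<1} \<Longrightarrow> ((\<lambda>t. v t \<bullet> l) has_real_derivative c t * (z t \<bullet> k) + d t * (z t \<bullet> l)) (at t)"
    and coefficients: "continuous_on {0<..<1} a" "continuous_on {0<..<1} b"
      "continuous_on {0<..<1} c" "continuous_on {0<..<1} d"
    and t0: "t0 \<in> {0<..<1}" "z t0 \<bullet> k = 0" "z t0 \<bullet> l = 0" and t: "t \<in> {0<..<1}"
  shows "z t \<bullet> k = 0 \<and> z t \<bullet> l = 0"
  by (rule linear_ode_pair_zero[OF convex_real_interval(8) component_deriv component_deriv acceleration
        coefficients t0 zero_imp_velocity_zero[OF k t0(1,2)] zero_imp_velocity_zero[OF l t0(1,3)] t])

lemma isolated_zero_impossible:
  assumes k: "k \<in> Basis" and t0: "t0 \<in> {0<..<1}" and zero: "z t0 \<bullet> k = 0"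
    and m: "isCont m t0" "m t0 \<noteq> 0" and sign: "\<And>t. t \<in> {0<..<1} \<Longrightarrow> (z t \<bullet> k) * m t \<le> 0"
    and acceleration: "((\<lambda>t. v t \<bullet> k) has_real_derivative \<gamma> * m t0) (at t0)" and "0 < \<gamma>"
  shows False
proof -
  have "\<forall>\<^sub>F t in at_right t0. 0 < (z t \<bullet> k) * m t"
    by (rule eventually_pos_mult_right_of_double_zero[where b = 1, OF component_deriv acceleration m \<open>0 < \<gamma>\<close>
          _ zero zero_imp_velocity_zero[OF k t0 zero]]) (use t0 in auto)
  moreover have "\<forall>\<^sub>F t in at_right t0. t \<in> {t0<..<1}"
    using t0 by (intro eventually_at_right_real) auto
  ultimately have "\<forall>\<^sub>F t in at_right t0. False"
  proof eventually_elim
    case (elim t)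
    then show False using sign[of t] t0 by auto
  qed
  then show False by simp
qed

end

section \<open>Zeros of a minimizing solution\<close>

lemma inner_orthogonal_components:
  fixes u w i j :: "real \<times> real"
  assumes "i \<in> Basis" "j \<in> Basis" "i \<noteq> j"
  shows "u \<bullet> w = (u \<bullet> i) * (w \<bullet> i) + (u \<bullet> j) * (w \<bullet> j)"
  using assms by (auto simp: Basis_prod_def inner_prod_def)

lemma closure_quadrant1: "closure quadrant1 = {p. 0 \<le> fst p \<and> 0 \<le> snd p}"
proof -
  have product: "quadrant1 = {0<..} \<times> {0<..}" by (auto simp: quadrant1_def)
  show ?thesis unfolding product closure_Times by auto
qed

lemma closure_quadrant4: "closure quadrant4 = {p. 0 \<le> fst p \<and> snd p \<le> 0}"
proof -
  have product: "quadrant4 = {0<..} \<times> {..<0}" by (auto simp: quadrant4_def)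
  show ?thesis unfolding product closure_Times by auto
qed

locale minimizing_solution = least_action_path "\<lambda>t. (Z1 t, Z2 t)" "\<lambda>t. (V1 t, V2 t)"
  for Z1 Z2 V1 V2 :: "real \<Rightarrow> pt" +
  assumes velocity_deriv: "\<And>t. t \<in> {0<..<1} \<Longrightarrow>
      ((\<lambda>t. (V1 t, V2 t)) has_vector_derivative jacobi_acceleration (Z1 t, Z2 t)) (at t)"
    and start_pos: "0 < fst (Z2 0)"
begin

abbreviation \<alpha> :: "real \<Rightarrow> real" where "\<alpha> t \<equiv> attraction1 (Z1 t, Z2 t)"
abbreviation \<beta> :: "real \<Rightarrow> real" where "\<beta> t \<equiv> attraction2 (Z1 t, Z2 t)"
abbreviation \<kappa> :: "real \<Rightarrow> real" where "\<kappa> t \<equiv> coupling (Z1 t, Z2 t)"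

lemma position_component_deriv:
  assumes "t \<in> {0<..<1}"
  shows "((\<lambda>t. Z1 t \<bullet> i) has_real_derivative V1 t \<bullet> i) (at t)"
    "((\<lambda>t. Z2 t \<bullet> i) has_real_derivative V2 t \<bullet> i) (at t)"
  using component_deriv[OF assms, of "(i, 0)"] component_deriv[OF assms, of "(0, i)"]
  by simp_all

lemma velocity_component_deriv:
  assumes "t \<in> {0<..<1}"
  shows "((\<lambda>t. V1 t \<bullet> i) has_real_derivative \<kappa> t * (Z1 t \<bullet> Z2 t) * (Z2 t \<bullet> i) - \<alpha> t * (Z1 t \<bullet> i)) (at t)"
    "((\<lambda>t. V2 t \<bullet> i) has_real_derivative
      3/4 * \<kappa> t * (Z1 t \<bullet> Z2 t) * (Z1 t \<bullet> i) - \<beta> t * (Z2 t \<bullet> i)) (at t)"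
  unfolding has_real_derivative_iff_has_vector_derivative
  using bounded_linear.has_vector_derivative[OF bounded_linear_inner_left velocity_deriv[OF assms],
      of "(i, 0)"]
    bounded_linear.has_vector_derivative[OF bounded_linear_inner_left velocity_deriv[OF assms],
      of "(0, i)"]
  by (simp_all add: jacobi_acceleration_def inner_diff_left)

lemma isCont_components:
  assumes "t \<in> {0<..<1}"
  shows "isCont (\<lambda>t. Z1 t \<bullet> i) t" "isCont (\<lambda>t. Z2 t \<bullet> i) t"
  by (rule DERIV_isCont[OF position_component_deriv(1)[OF assms]]
      DERIV_isCont[OF position_component_deriv(2)[OF assms]])+

lemma continuous_on_positions: "continuous_on {0<..<1} Z1" "continuous_on {0<..<1} Z2"
proof -
  have "continuous_on {0<..<1} (\<lambda>t. (Z1 t, Z2 t))"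
    by (rule continuous_on_subset[OF continuous_path]) auto
  from continuous_on_fst[OF this] continuous_on_snd[OF this]
  show "continuous_on {0<..<1} Z1" "continuous_on {0<..<1} Z2" by simp_all
qed

lemma continuous_on_coefficients:
  "continuous_on {0<..<1} \<alpha>" "continuous_on {0<..<1} \<beta>" "continuous_on {0<..<1} \<kappa>"
  by (intro continuous_on_attraction_coupling continuous_on_Pair continuous_on_positions
      collision_free_path; simp)+

text \<open>The accelerations of each of the following pairs are linear in the pair: for parallel components
  of $Z_1$ and $Z_2$ with $Z_1 \cdot Z_2$ as a coefficient, otherwise because $Z_1 \cdot Z_2$ is itself
  linear in the pair.\<close>
lemma parallel_components_vanish:
  assumes i: "i \<in> Basis" and t0: "t0 \<in> {0<..<1}" "Z1 t0 \<bullet> i = 0" "Z2 t0 \<bullet> i = 0" and t: "t \<in> {0<..<1}"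
  shows "Z1 t \<bullet> i = 0 \<and> Z2 t \<bullet> i = 0"
proof -
  define p where "p t = \<kappa> t * (Z1 t \<bullet> Z2 t)" for t
  have p: "continuous_on {0<..<1} p"
    unfolding p_def by (intro continuous_intros continuous_on_coefficients continuous_on_positions)
  have "(Z1 t, Z2 t) \<bullet> (i, 0) = 0 \<and> (Z1 t, Z2 t) \<bullet> (0, i) = 0"
  proof (rule linear_components_vanish[where a = "\<lambda>t. - \<alpha> t" and b = p and c = "\<lambda>t. 3/4 * p t"
        and d = "\<lambda>t. - \<beta> t", OF _ _ _ _ _ _ _ _ t0(1) _ _ t])
    fix t :: real assume "t \<in> {0<..<1}"
    note acceleration = velocity_component_deriv[OF this, of i]
    show "((\<lambda>t. (V1 t, V2 t) \<bullet> (i, 0)) has_real_derivative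
        - \<alpha> t * ((Z1 t, Z2 t) \<bullet> (i, 0)) + p t * ((Z1 t, Z2 t) \<bullet> (0, i))) (at t)"
      using acceleration(1) by (simp add: p_def)
    show "((\<lambda>t. (V1 t, V2 t) \<bullet> (0, i)) has_real_derivative
        3/4 * p t * ((Z1 t, Z2 t) \<bullet> (i, 0)) + - \<beta> t * ((Z1 t, Z2 t) \<bullet> (0, i))) (at t)"
      using acceleration(2) by (simp add: p_def mult.assoc)
  qed (use i t0 p in \<open>auto simp: Basis_prod_def intro!: continuous_intros continuous_on_coefficients\<close>)
  then show ?thesis by simp
qed

lemma orthogonal_components_vanish:
  assumes ij: "i \<in> Basis" "j \<in> Basis" "i \<noteq> j"
    and t0: "t0 \<in> {0<..<1}" "Z1 t0 \<bullet> i = 0" "Z2 t0 \<bullet> j = 0" and t: "t \<in> {0<..<1}"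
  shows "Z1 t \<bullet> i = 0 \<and> Z2 t \<bullet> j = 0"
proof -
  have "(Z1 t, Z2 t) \<bullet> (i, 0) = 0 \<and> (Z1 t, Z2 t) \<bullet> (0, j) = 0"
  proof (rule linear_components_vanish[OF _ _ _ _ _ _ _ _ t0(1) _ _ t])
    fix t :: real assume t: "t \<in> {0<..<1}"
    show "((\<lambda>t. (V1 t, V2 t) \<bullet> (i, 0)) has_real_derivative
        (\<kappa> t * (Z2 t \<bullet> i) * (Z2 t \<bullet> i) - \<alpha> t) * ((Z1 t, Z2 t) \<bullet> (i, 0))
        + \<kappa> t * (Z1 t \<bullet> j) * (Z2 t \<bullet> i) * ((Z1 t, Z2 t) \<bullet> (0, j))) (at t)"
      using velocity_component_deriv(1)[OF t, of i]
      by (simp add: inner_orthogonal_components[OF ij, of "Z1 t" "Z2 t"] algebra_simps)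
    show "((\<lambda>t. (V1 t, V2 t) \<bullet> (0, j)) has_real_derivative
        3/4 * \<kappa> t * (Z2 t \<bullet> i) * (Z1 t \<bullet> j) * ((Z1 t, Z2 t) \<bullet> (i, 0))
        + (3/4 * \<kappa> t * (Z1 t \<bullet> j) * (Z1 t \<bullet> j) - \<beta> t) * ((Z1 t, Z2 t) \<bullet> (0, j))) (at t)"
      using velocity_component_deriv(2)[OF t, of j]
      by (simp add: inner_orthogonal_components[OF ij, of "Z1 t" "Z2 t"] algebra_simps)
  qed (use ij t0 in \<open>auto simp: Basis_prod_def
      intro!: continuous_intros continuous_on_coefficients continuous_on_positions\<close>)
  then show ?thesis by simp
qed

lemma Z2_components_vanish:
  assumes ij: "i \<in> Basis" "j \<in> Basis" "i \<noteq> j"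
    and t0: "t0 \<in> {0<..<1}" "Z2 t0 \<bullet> i = 0" "Z2 t0 \<bullet> j = 0" and t: "t \<in> {0<..<1}"
  shows "Z2 t \<bullet> i = 0 \<and> Z2 t \<bullet> j = 0"
proof -
  have "(Z1 t, Z2 t) \<bullet> (0, i) = 0 \<and> (Z1 t, Z2 t) \<bullet> (0, j) = 0"
  proof (rule linear_components_vanish[OF _ _ _ _ _ _ _ _ t0(1) _ _ t])
    fix t :: real assume t: "t \<in> {0<..<1}"
    show "((\<lambda>t. (V1 t, V2 t) \<bullet> (0, i)) has_real_derivative
        (3/4 * \<kappa> t * (Z1 t \<bullet> i) * (Z1 t \<bullet> i) - \<beta> t) * ((Z1 t, Z2 t) \<bullet> (0, i))
        + 3/4 * \<kappa> t * (Z1 t \<bullet> j) * (Z1 t \<bullet> i) * ((Z1 t, Z2 t) \<bullet> (0, j))) (at t)"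
      using velocity_component_deriv(2)[OF t, of i]
      by (simp add: inner_orthogonal_components[OF ij, of "Z1 t" "Z2 t"] algebra_simps)
    show "((\<lambda>t. (V1 t, V2 t) \<bullet> (0, j)) has_real_derivative
        3/4 * \<kappa> t * (Z1 t \<bullet> i) * (Z1 t \<bullet> j) * ((Z1 t, Z2 t) \<bullet> (0, i))
        + (3/4 * \<kappa> t * (Z1 t \<bullet> j) * (Z1 t \<bullet> j) - \<beta> t) * ((Z1 t, Z2 t) \<bullet> (0, j))) (at t)"
      using velocity_component_deriv(2)[OF t, of j]
      by (simp add: inner_orthogonal_components[OF ij, of "Z1 t" "Z2 t"] algebra_simps)
  qed (use ij t0 in \<open>auto simp: Basis_prod_def
      intro!: continuous_intros continuous_on_coefficients continuous_on_positions\<close>)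
  then show ?thesis by simp
qed

lemma sign_condition_components:
  assumes "i \<in> Basis" "j \<in> Basis" "i \<noteq> j" "t \<in> {0<..<1}"
  shows "((Z1 t \<bullet> i) * (Z2 t \<bullet> i)) * ((Z1 t \<bullet> j) * (Z2 t \<bullet> j)) \<le> 0"
  using sign_condition[OF assms(4)] assms(1-3) by (auto simp: Basis_prod_def inner_prod_def mult_ac)

text \<open>The product of the four components must not become positive, but at a double zero of one of them
  Newton's equations give this component the sign of the product of the others.\<close>
lemma single_zero_impossible:
  assumes ij: "i \<in> Basis" "j \<in> Basis" "i \<noteq> j" and t0: "t0 \<in> {0<..<1}"
  shows "\<lbrakk>Z1 t0 \<bullet> i = 0; Z1 t0 \<bullet> j \<noteq> 0; Z2 t0 \<bullet> i \<noteq> 0; Z2 t0 \<bullet> j \<noteq> 0\<rbrakk> \<Longrightarrow> False"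
    and "\<lbrakk>Z2 t0 \<bullet> i = 0; Z2 t0 \<bullet> j \<noteq> 0; Z1 t0 \<bullet> i \<noteq> 0; Z1 t0 \<bullet> j \<noteq> 0\<rbrakk> \<Longrightarrow> False"
proof -
  have coupling: "0 < \<kappa> t0" "0 < 3/4 * \<kappa> t0"
    using coupling_pos[OF collision_free_path, of t0] t0 by simp_all
  have basis: "(i, 0) \<in> Basis" "(0, i) \<in> Basis" using ij(1) by (auto simp: Basis_prod_def)
  show False if zero: "Z1 t0 \<bullet> i = 0" and others: "Z1 t0 \<bullet> j \<noteq> 0" "Z2 t0 \<bullet> i \<noteq> 0" "Z2 t0 \<bullet> j \<noteq> 0"
  proof (rule isolated_zero_impossible[OF basis(1) t0])
    let ?m = "\<lambda>t. (Z2 t \<bullet> i) * ((Z1 t \<bullet> j) * (Z2 t \<bullet> j))"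
    show "isCont ?m t0" by (intro continuous_intros isCont_components t0)
    show "(Z1 t, Z2 t) \<bullet> (i, 0) * ?m t \<le> 0" if "t \<in> {0<..<1}" for t
      using sign_condition_components[OF ij that] by (simp add: mult.assoc)
    show "((\<lambda>t. (V1 t, V2 t) \<bullet> (i, 0)) has_real_derivative \<kappa> t0 * ?m t0) (at t0)"
      using velocity_component_deriv(1)[OF t0, of i] zero
      by (simp add: inner_orthogonal_components[OF ij, of "Z1 t0" "Z2 t0"] mult_ac)
  qed (use zero others coupling in simp_all)
  show False if zero: "Z2 t0 \<bullet> i = 0" and others: "Z2 t0 \<bullet> j \<noteq> 0" "Z1 t0 \<bullet> i \<noteq> 0" "Z1 t0 \<bullet> j \<noteq> 0"
  proof (rule isolated_zero_impossible[OF basis(2) t0])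
    let ?m = "\<lambda>t. (Z1 t \<bullet> i) * ((Z1 t \<bullet> j) * (Z2 t \<bullet> j))"
    show "isCont ?m t0" by (intro continuous_intros isCont_components t0)
    show "(Z1 t, Z2 t) \<bullet> (0, i) * ?m t \<le> 0" if "t \<in> {0<..<1}" for t
      using sign_condition_components[OF ij that] by (simp add: mult_ac)
    show "((\<lambda>t. (V1 t, V2 t) \<bullet> (0, i)) has_real_derivative (3/4 * \<kappa> t0) * ?m t0) (at t0)"
      using velocity_component_deriv(2)[OF t0, of i] zero
      by (simp add: inner_orthogonal_components[OF ij, of "Z1 t0" "Z2 t0"] mult_ac)
  qed (use zero others coupling in simp_all)
qed

lemma x2_not_identically_zero: "\<exists>t\<in>{0<..<1}. fst (Z2 t) \<noteq> 0"
proof (rule ccontr)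
  assume "\<not> ?thesis"
  moreover have "closed {u :: config. fst (snd u) = 0}" by (intro closed_Collect_eq continuous_intros)
  ultimately have "fst (Z2 0) = 0" using path_in_closed_set[of "{u. fst (snd u) = 0}" 0] by simp
  with start_pos show False by simp
qed

lemma x1_y2_not_identically_zero: "\<exists>t\<in>{0<..<1}. fst (Z1 t) \<noteq> 0 \<or> snd (Z2 t) \<noteq> 0"
proof (rule ccontr)
  assume "\<not> ?thesis"
  moreover have "closed {u :: config. fst (fst u) = 0 \<and> snd (snd u) = 0}"
    by (intro closed_Collect_conj closed_Collect_eq continuous_intros)
  ultimately have "fst (Z1 1) = 0 \<and> snd (Z2 1) = 0"
    using path_in_closed_set[of "{u. fst (fst u) = 0 \<and> snd (snd u) = 0}" 1] by simp
  then have "Z1 1 = 0" using finish by (simp add: end_config_def prod_eq_iff)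
  then show False using collision_free_path[of 1] by (simp add: collision_free_def dist12_def)
qed

lemma basis_x_y: "(1, 0) \<in> (Basis :: pt set)" "(0, 1) \<in> (Basis :: pt set)" "(1, 0) \<noteq> (0, 1 :: real)"
  by (simp_all add: Basis_prod_def)

lemma x_nonzero:
  assumes t: "t \<in> {0<..<1}"
  shows "fst (Z1 t) \<noteq> 0" "fst (Z2 t) \<noteq> 0"
proof -
  note xy = basis_x_y basis_x_y(3)[symmetric]
  have "fst (Z1 t) \<noteq> 0 \<or> snd (Z1 t) \<noteq> 0"
    using collision_free_path[of t] t by (auto simp: collision_free_def dist12_def prod_eq_iff)
  moreover have "fst (Z1 t) \<noteq> 0 \<or> fst (Z2 t) \<noteq> 0"
    using parallel_components_vanish[OF xy(1) t] x2_not_identically_zero by (auto simp: inner_prod_def)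
  moreover have "fst (Z1 t) \<noteq> 0 \<or> snd (Z2 t) \<noteq> 0"
    using orthogonal_components_vanish[OF xy(1-3) t] x1_y2_not_identically_zero
    by (auto simp: inner_prod_def)
  moreover have "snd (Z1 t) \<noteq> 0 \<or> fst (Z2 t) \<noteq> 0"
    using orthogonal_components_vanish[OF xy(2,1,4) t] x2_not_identically_zero
    by (auto simp: inner_prod_def)
  moreover have "fst (Z2 t) \<noteq> 0 \<or> snd (Z2 t) \<noteq> 0"
    using Z2_components_vanish[OF xy(1-3) t] x2_not_identically_zero by (auto simp: inner_prod_def)
  ultimately show "fst (Z1 t) \<noteq> 0" "fst (Z2 t) \<noteq> 0"
    using single_zero_impossible[OF xy(1-3) t] by (auto simp: inner_prod_def)
qed

lemma y_zero_or_nonzero: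
  "(\<forall>t\<in>{0<..<1}. snd (Z1 t) = 0 \<and> snd (Z2 t) = 0) \<or> (\<forall>t\<in>{0<..<1}. snd (Z1 t) \<noteq> 0 \<and> snd (Z2 t) \<noteq> 0)"
proof -
  have zero_iff: "snd (Z1 t) = 0 \<longleftrightarrow> snd (Z2 t) = 0" if "t \<in> {0<..<1}" for t
    using single_zero_impossible[OF basis_x_y(2,1) basis_x_y(3)[symmetric] that] x_nonzero[OF that]
    by (auto simp: inner_prod_def)
  moreover have "snd (Z1 t) = 0 \<and> snd (Z2 t) = 0"
    if "t0 \<in> {0<..<1}" "snd (Z1 t0) = 0" "t \<in> {0<..<1}" for t0 t
    using parallel_components_vanish[OF basis_x_y(2) that(1) _ _ that(3)] zero_iff[OF that(1)] that(2)
    by (auto simp: inner_prod_def)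
  ultimately show ?thesis by blast
qed

lemma x_positive:
  assumes "0 < fst (Z1 1)" and "t \<in> {0<..<1}"
  shows "0 < fst (Z1 t)" "0 < fst (Z2 t)"
proof -
  have "continuous_on UNIV (\<lambda>u :: config. fst (fst u))" "continuous_on UNIV (\<lambda>u :: config. fst (snd u))"
    by (intro continuous_intros)+
  from path_functional_positive[OF this(1), of 1 t] path_functional_positive[OF this(2), of 0 t]
  show "0 < fst (Z1 t)" "0 < fst (Z2 t)"
    using assms x_nonzero start_pos by simp_all
qed

lemma y_opposite_signs:
  assumes "0 < fst (Z1 1)"
  shows "(\<forall>t\<in>{0<..<1}. 0 \<le> snd (Z1 t) \<and> snd (Z2 t) \<le> 0) \<or>
    (\<forall>t\<in>{0<..<1}. snd (Z1 t) \<le> 0 \<and> 0 \<le> snd (Z2 t))"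
proof -
  have opposite: "snd (Z1 t) * snd (Z2 t) \<le> 0" if t: "t \<in> {0<..<1}" for t
  proof -
    have "0 < fst (Z1 t) * fst (Z2 t)" using x_positive[OF assms t] by simp
    moreover have "(fst (Z1 t) * fst (Z2 t)) * (snd (Z1 t) * snd (Z2 t)) \<le> 0"
      using sign_condition[OF t] by (simp only: fst_conv snd_conv)
    ultimately show ?thesis by (simp only: mult_le_0_iff[of "fst (Z1 t) * fst (Z2 t)"]) linarith
  qed
  have "continuous_on UNIV (\<lambda>u :: config. snd (fst u))" by (intro continuous_intros)
  from path_functional_constant_sign[OF this] y_zero_or_nonzero
  consider (collinear) "\<forall>t\<in>{0<..<1}. snd (Z1 t) = 0 \<and> snd (Z2 t) = 0"
    | (positive) "\<forall>t\<in>{0<..<1}. 0 < snd (Z1 t)" | (negative) "\<forall>t\<in>{0<..<1}. snd (Z1 t) < 0"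
    by auto
  then show ?thesis
  proof cases
    case positive
    then have "\<forall>t\<in>{0<..<1}. 0 \<le> snd (Z1 t) \<and> snd (Z2 t) \<le> 0"
      using opposite by (metis less_imp_le mult_pos_pos not_le)
    then show ?thesis ..
  next
    case negative
    then have "\<forall>t\<in>{0<..<1}. snd (Z1 t) \<le> 0 \<and> 0 \<le> snd (Z2 t)"
      using opposite by (metis less_imp_le mult_neg_neg not_le)
    then show ?thesis ..
  qed simp
qed

lemma quadrants:
  assumes "0 < fst (Z1 1)"
  shows "(\<forall>t\<in>{0..1}. Z1 t \<in> closure quadrant1 \<and> Z2 t \<in> closure quadrant4) \<or>
    (\<forall>t\<in>{0..1}. Z1 t \<in> closure quadrant4 \<and> Z2 t \<in> closure quadrant1)"
proof -
  have closed: "closed (closure quadrant1 \<times> closure quadrant4)"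
    "closed (closure quadrant4 \<times> closure quadrant1)"
    by (intro closed_Times closed_closure)+
  show ?thesis
    using y_opposite_signs[OF assms]
  proof
    assume "\<forall>t\<in>{0<..<1}. 0 \<le> snd (Z1 t) \<and> snd (Z2 t) \<le> 0"
    then show ?thesis
      using path_in_closed_set[OF closed(1)] x_positive[OF assms]
      by (auto simp: closure_quadrant1 closure_quadrant4 less_imp_le)
  next
    assume "\<forall>t\<in>{0<..<1}. snd (Z1 t) \<le> 0 \<and> 0 \<le> snd (Z2 t)"
    then show ?thesis
      using path_in_closed_set[OF closed(2)] x_positive[OF assms]
      by (auto simp: closure_quadrant1 closure_quadrant4 less_imp_le)
  qed
qed

end

lemma minimizer_imp_minimizing_solution:
  assumes minimizer: "minimizer q1 q2 q3"
    and collfree: "\<forall>t\<in>{0<..1}. q1 t \<noteq> q2 t \<and> q1 t \<noteq> q3 t \<and> q2 t \<noteq> q3 t"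
    and newton: "newton_on {0<..<1} q1 q2 q3"
    and Z: "\<And>t. jacobi (q1 t) (q2 t) (q3 t) = (Z1 t, Z2 t)" and start_pos: "0 < fst (Z2 0)"
  obtains V1 V2 where "minimizing_solution Z1 Z2 V1 V2"
proof -
  let ?z = "\<lambda>t. (Z1 t, Z2 t)"
  have admissible: "admissible q1 q2 q3" using minimizer by (simp add: minimizer_def)
  have bodies: "body1 (?z t) = q1 t \<and> body2 (?z t) = q2 t \<and> body3 (?z t) = q3 t" if "t \<in> {0..1}" for t
    using admissible that bodies_jacobi unfolding admissible_def Z[symmetric] by simp
  have free: "collision_free (?z t)" if "t \<in> {0<..1}" for t
    using collfree bodies[of t] that by (auto simp: collision_free_iff_bodies)
  have "continuous_on {0..1} q1" "continuous_on {0..1} q2" "continuous_on {0..1} q3"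
    using admissible H1_path_continuous_on by (auto simp: admissible_def)
  then have continuous: "continuous_on {0..1} ?z"
    unfolding Z[symmetric] jacobi_def by (intro continuous_intros)
  obtain v where v: "\<And>t. t \<in> {0<..<1} \<Longrightarrow> (?z has_vector_derivative v t) (at t)"
    and acceleration: "\<And>t. t \<in> {0<..<1} \<Longrightarrow> (v has_vector_derivative jacobi_acceleration (?z t)) (at t)"
    by (rule newton_on_imp_jacobi_acceleration[OF newton, unfolded Z])
      (use admissible free in \<open>auto simp: admissible_def\<close>)
  have action: "action q1 q2 q3 = lagrangian_action ?z v"
    using v free bodies by (intro action_eq_lagrangian_action[of "{}"]) auto
  have "minimizing_solution Z1 Z2 (\<lambda>t. fst (v t)) (\<lambda>t. snd (v t))"
  proof unfold_locales
    have "continuous_on {0<..<1} v"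
      by (intro continuous_at_imp_continuous_on ballI has_vector_derivative_continuous[OF acceleration])
    then show "continuous_on {0<..<1} (\<lambda>t. (fst (v t), snd (v t)))" by simp
    show "start_config (?z 0)" "end_config (?z 1)"
      using admissible bodies[of 0] bodies[of 1]
      by (simp_all add: admissible_def start_config_iff_bodies end_config_iff_bodies)
    show "lagrangian_action ?z (\<lambda>t. (fst (v t), snd (v t))) < \<infinity>"
      using minimizer_action_finite[OF minimizer] by (simp add: action)
    show "lagrangian_action ?z (\<lambda>t. (fst (v t), snd (v t))) \<le> lagrangian_action u d"
      if "competitor u d" for u d
      using minimizer_action_le[OF minimizer that] by (simp add: action)
  qed (use continuous v acceleration free start_pos in simp_all)
  then show thesis by (rule that)
qed

theorem theorem5p8:
  fixes q1 q2 q3 Z1 Z2 :: "real \<Rightarrow> real \<times> real"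
  assumes min: "minimizer q1 q2 q3"
    and collfree: "\<forall>t\<in>{0<..1}. q1 t \<noteq> q2 t \<and> q1 t \<noteq> q3 t \<and> q2 t \<noteq> q3 t"
    and newton: "newton_on {0<..<1} q1 q2 q3"
    and Z1_def: "\<And>t. Z1 t = q1 t - q2 t"
    and Z2_def: "\<And>t. Z2 t = q3 t - (1/2) *\<^sub>R (q1 t + q2 t)"
    and Z1_0: "Z1 0 = 0"
    and Z2_0: "Z2 0 \<in> pos_x_axis"
    and Z1_1: "Z1 1 \<in> closure quadrant1"
    and Z2_1: "Z2 1 \<in> closure quadrant4"
  shows "(Z1 1 \<in> quadrant1 \<or> Z2 1 \<in> quadrant4 \<longrightarrow>
            (\<forall>t\<in>{0..1}. Z1 t \<in> closure quadrant1 \<and> Z2 t \<in> closure quadrant4))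
       \<and> (Z1 1 \<in> pos_x_axis \<and> Z2 1 \<in> pos_x_axis \<longrightarrow>
            ((\<forall>t\<in>{0..1}. Z1 t \<in> closure quadrant1 \<and> Z2 t \<in> closure quadrant4) \<or>
             (\<forall>t\<in>{0..1}. Z1 t \<in> closure quadrant4 \<and> Z2 t \<in> closure quadrant1)))"
proof -
  have "jacobi (q1 t) (q2 t) (q3 t) = (Z1 t, Z2 t)" for t
    by (simp add: jacobi_def Z1_def Z2_def)
  moreover have "0 < fst (Z2 0)" using Z2_0 by (simp add: pos_x_axis_def)
  ultimately obtain V1 V2 where "minimizing_solution Z1 Z2 V1 V2"
    by (rule minimizer_imp_minimizing_solution[OF min collfree newton])
  then interpret minimizing_solution Z1 Z2 V1 V2 .
  show ?thesis
  proof (intro conjI impI)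
    assume "Z1 1 \<in> quadrant1 \<or> Z2 1 \<in> quadrant4"
    then have "0 < fst (Z1 1)" "0 < snd (Z1 1)"
      using finish by (auto simp: end_config_def quadrant1_def quadrant4_def)
    moreover from \<open>0 < snd (Z1 1)\<close> have "Z1 1 \<notin> closure quadrant4" by (simp add: closure_quadrant4)
    ultimately show "\<forall>t\<in>{0..1}. Z1 t \<in> closure quadrant1 \<and> Z2 t \<in> closure quadrant4"
      using quadrants by force
  next
    assume "Z1 1 \<in> pos_x_axis \<and> Z2 1 \<in> pos_x_axis"
    then show "(\<forall>t\<in>{0..1}. Z1 t \<in> closure quadrant1 \<and> Z2 t \<in> closure quadrant4) \<or>
        (\<forall>t\<in>{0..1}. Z1 t \<in> closure quadrant4 \<and> Z2 t \<in> closure quadrant1)"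
      by (intro quadrants) (simp add: pos_x_axis_def)
  qed
qed

end
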